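(* Consider a system of $n\ge 3$ oblivious fully synchronous robots without chirality, and let $C_0$ be an initial configuration. Then \textsc{Visit-All} is solvable in $1$ step from $C_0$ if and only if $C_0\notin\mathcal C_\odot$ and either there are no symmetry axes of $C_0$, or there exists a unique symmetry axis of $C_0$ and it does not intersect any point of $C_0$.
   Context: Model. There are $n\ge 3$ robots $r_0,\dots,r_{n-1}$, which are points in $\mathbb R^2$. A configuration is a tuple $C=(p_0,\dots,p_{n-1})$ of points, $p_i$ being the position of $r_i$ in a fixed global coordinate system unknown to the robots; an initial configuration consists of pairwise distinct points. Each robot $r_i$ has a local Cartesian coordinate system $Z_i$, always centred at its current position, whose orientation and unit length are fixed over time but arbitrary and possibly different for different robots. No chirality: the handedness of the $Z_i$ is also arbitrary and may differ between robots. Robots are anonymous, oblivious and deterministic: an algorithm $\mathcal A$ is one function, the same for all robots, mapping a snapshot (the multiset of positions of all robots expressed in the observing robot's local coordinate system, its own position being the origin) to a destination point (in the same local coordinates). In each round all robots simultaneously take a snapshot, compute their destination, and move exactly to it. Thus $C_0$ and $Z=(Z_0,\dots,Z_{n-1})$ determine the run $(C_0,C_1,C_2,\dots)$ of $\mathcal A$. Permutations. For a permutation $\pi$ of $\{0,\dots,n-1\}$ put $\pi(C)=(p_{\pi(0)},\dots,p_{\pi(n-1)})$. $\Pi_n$ is the set of permutations that are a single $n$-cycle. Problem. $\mathcal A$ solves \textsc{Visit-All} in $1$ step from $C_0$ if for every admissible $Z$ the run from $C_0$ satisfies: there is $\pi\in\Pi_n$ with $C_i=\pi^i(C_0)$ for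 all $i\ge 0$. The problem is solvable in $1$ step from $C_0$ if some algorithm does this. $\mathcal C_\odot$ is the set of configurations $C$ having exactly one robot $r_c$ (the central robot) at the centre of the smallest circle enclosing $C$, and such that for some integer $k>1$ the rotation by $2\pi/k$ about the position of $r_c$ maps the multiset of points of $C$ to itself. A symmetry axis of $C$ is a line such that reflection in it maps the set of points of $C$ to itself.
   Formalization: A symmetry axis is required not to contain all points of the configuration; otherwise the line through collinear robots would count as an axis and the claim would fail, e.g. for robots at 0, 1, 3 on a line, where Visit-All is solvable in 1 step. *)

theory Defs
  imports "HOL-Analysis.Analysis" "HOL-Combinatorics.Combinatorics"
begin

text \<open>The plane is the type \<^typ>\<open>complex\<close>, used as a two-dimensional Euclidean space.
  A configuration of n robots is a function on indices of which only the values at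
  indices below n matter.\<close>

type_synonym config = "nat \<Rightarrow> complex"

type_synonym algorithm = "complex multiset \<Rightarrow> complex"

definition points :: "nat \<Rightarrow> config \<Rightarrow> complex set" where
  "points n C = C ` {..<n}"

definition points_mset :: "nat \<Rightarrow> config \<Rightarrow> complex multiset" where
  "points_mset n C = image_mset C (mset_set {..<n})"

definition initial_config :: "nat \<Rightarrow> config \<Rightarrow> bool" where
  "initial_config n C \<longleftrightarrow> inj_on C {..<n}"

text \<open>A local coordinate system centred at the robot's own position is represented by the map
  that sends a global displacement vector to its local coordinates: u is the unit length, and f
  encodes the directions of the two axes. As f may reverse the orientation of the plane, the
  handedness is arbitrary.\<close>

definition local_frame :: "(complex \<Rightarrow> complex) \<Rightarrow> bool" where
  "local_frame T \<longleftrightarrow>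
     (\<exists>u f. u > 0 \<and> orthogonal_transformation f \<and> T = (\<lambda>v. f v /\<^sub>R u))"

definition snapshot :: "nat \<Rightarrow> (complex \<Rightarrow> complex) \<Rightarrow> config \<Rightarrow> complex \<Rightarrow> complex multiset" where
  "snapshot n T C p = image_mset (\<lambda>q. T (q - p)) (points_mset n C)"

text \<open>The destination is computed in local coordinates and then converted back.\<close>

definition fsync_round :: "nat \<Rightarrow> algorithm \<Rightarrow> (nat \<Rightarrow> complex \<Rightarrow> complex) \<Rightarrow> config \<Rightarrow> config" where
  "fsync_round n A Z C = (\<lambda>i. C i + inv (Z i) (A (snapshot n (Z i) C (C i))))"

definition run :: "nat \<Rightarrow> algorithm \<Rightarrow> (nat \<Rightarrow> complex \<Rightarrow> complex) \<Rightarrow> config \<Rightarrow> nat \<Rightarrow> config" where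
  "run n A Z C t = (fsync_round n A Z ^^ t) C"

definition n_cycles :: "nat \<Rightarrow> (nat \<Rightarrow> nat) set" where
  "n_cycles n = {\<pi>. \<pi> permutes {..<n} \<and> cyclic_on \<pi> {..<n}}"

definition solves_visit_all_1_step :: "nat \<Rightarrow> algorithm \<Rightarrow> config \<Rightarrow> bool" where
  "solves_visit_all_1_step n A C \<longleftrightarrow>
     (\<forall>Z. (\<forall>i<n. local_frame (Z i)) \<longrightarrow>
        (\<exists>\<pi>\<in>n_cycles n. \<forall>t. \<forall>i<n. run n A Z C t i = C ((\<pi> ^^ t) i)))"

definition visit_all_solvable_1_step :: "nat \<Rightarrow> config \<Rightarrow> bool" where
  "visit_all_solvable_1_step n C \<longleftrightarrow> (\<exists>A. solves_visit_all_1_step n A C)"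

definition smallest_enclosing_circle :: "complex set \<Rightarrow> complex \<Rightarrow> real \<Rightarrow> bool" where
  "smallest_enclosing_circle S c r \<longleftrightarrow>
     S \<subseteq> cball c r \<and> (\<forall>c' r'. S \<subseteq> cball c' r' \<longrightarrow> r \<le> r')"

definition rotation_about :: "complex \<Rightarrow> real \<Rightarrow> complex \<Rightarrow> complex" where
  "rotation_about c \<theta> z = c + cis \<theta> * (z - c)"

definition C_odot :: "nat \<Rightarrow> config set" where
  "C_odot n = {C. \<exists>c r. smallest_enclosing_circle (points n C) c r
     \<and> (\<exists>!i. i < n \<and> C i = c)
     \<and> (\<exists>k::nat. k > 1 \<and>
          image_mset (rotation_about c (2 * pi / real k)) (points_mset n C) = points_mset n C)}"

definition is_line :: "complex set \<Rightarrow> bool" where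
  "is_line L \<longleftrightarrow> affine L \<and> aff_dim L = 1"

text \<open>The closest point of L is the foot of the perpendicular from z to L.\<close>

definition reflection_in :: "complex set \<Rightarrow> complex \<Rightarrow> complex" where
  "reflection_in L z = 2 *\<^sub>R closest_point L z - z"

text \<open>The condition that L does not contain all the points matters only for collinear
  configurations, see the lemma below; there it excludes the line through all robots, the
  reflection in which moves no robot. If that line counted as an axis, the characterization
  would fail: with robots at 0, 1 and 3 on the real line it would be the unique axis and would
  contain robots, but the three robots can tell themselves apart and can move in the cycle
  0, 1, 3, whatever their frames are.\<close>

definition symmetry_axis :: "nat \<Rightarrow> config \<Rightarrow> complex set \<Rightarrow> bool" where
  "symmetry_axis n C L \<longleftrightarrow>
     is_line L \<and> reflection_in L ` points n C = points n C \<and> \<not> points n C \<subseteq> L"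

lemma symmetry_axis_noncollinear:
  assumes "\<not> collinear (points n C)"
  shows "symmetry_axis n C L \<longleftrightarrow> is_line L \<and> reflection_in L ` points n C = points n C"
proof -
  have "\<not> points n C \<subseteq> L" if "is_line L"
    using that assms collinear_subset[of L "points n C"]
    by (auto simp: is_line_def collinear_aff_dim)
  then show ?thesis
    by (auto simp: symmetry_axis_def)
qed

end

theory Submission
  imports Defs
begin

text \<open>Since the other robots occupy all points but one, the destination of a robot cannot depend on
  its frame, so an algorithm amounts to an \<open>n\<close>-cycle that commutes with all symmetries of the
  configuration. The centralizer of an \<open>n\<close>-cycle is the cyclic group generated by it, which acts
  freely. Hence no symmetry may fix a robot without fixing all robots, and no two distinct
  involutions, in particular no two reflections, may occur. Conversely, under the stated
  condition the symmetries form a cyclic group acting freely, namely rotations or one reflection,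
  and interleaving the orbits of a generator gives an \<open>n\<close>-cycle of which it is a power.\<close>

section \<open>Permutations commuting with a cyclic permutation\<close>

text \<open>Turning a commuting cycle into an algorithm rests on two further points. Frames may
  differ in scale, so equal views must be shown to come from an isometry and not merely from a
  similarity. And every later configuration is the initial one with the robots relabelled, so an
  oblivious algorithm that looks up its view reproduces the cycle forever. The geometric conditions
  come from placing the origin at the centroid, which every symmetry fixes. A rotation other than
  the identity fixes a robot only if the robot sits at the centroid, which leads to
  \<open>C_odot\<close>; a reflection fixes exactly the robots on its axis. The product of a
  rotation and a reflection is again a reflection, so a unique axis leaves room for just one
  nontrivial symmetry. Symmetries are compared as permutations of the robots, so the reflection in a
  line through all robots counts as the identity.\<close>

lemma funpow_commute_on:
  assumes "\<And>x. x \<in> X \<Longrightarrow> f (g x) = g (f x)" "\<And>x. x \<in> X \<Longrightarrow> g x \<in> X" "x \<in> X"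
  shows "f ((g ^^ j) x) = (g ^^ j) (f x)"
proof -
  have "(g ^^ j) x \<in> X \<and> f ((g ^^ j) x) = (g ^^ j) (f x)"
    by (induction j) (auto simp: assms)
  then show ?thesis ..
qed

text \<open>Each \<open>y\<close> is an iterate of \<open>x\<close> under \<pi>, and a commuting map
  is carried along from \<open>x\<close> to that iterate. With \<open>g\<close> the identity, this
  says that a commuting map with one fixed point fixes everything, that is, the centralizer acts
  freely.\<close>

lemma cyclic_on_commuting_eqI:
  assumes "cyclic_on \<pi> X" "x \<in> X"
    and "\<And>y. y \<in> X \<Longrightarrow> \<pi> (f y) = f (\<pi> y)" "\<And>y. y \<in> X \<Longrightarrow> \<pi> (g y) = g (\<pi> y)"
    and "f x = g x" "y \<in> X"
  shows "f y = g y"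
proof -
  have in_X: "\<pi> z \<in> X" if "z \<in> X" for z
    using assms(1) that by (rule cyclic_on_inI)
  have "y \<in> orbit \<pi> x"
    using assms(1,2,6) by (auto simp: cyclic_on_alldef)
  then obtain j where j: "y = (\<pi> ^^ j) x"
    by (auto simp: orbit_altdef)
  have "f y = (\<pi> ^^ j) (f x)" "g y = (\<pi> ^^ j) (g x)"
    unfolding j using assms(2-4) in_X
    by (auto intro!: funpow_commute_on[where X=X])
  then show ?thesis
    using assms(5) by simp
qed

text \<open>Writing \<open>f x\<close> as the \<open>a\<close>-th iterate of \<open>x\<close>,
  commutation turns \<open>f (f x) = x\<close> into a return to \<open>x\<close> after
  \<open>2 * a\<close> steps. Since \<open>0 < a < d\<close> for the period \<open>d\<close>, the
  only possibility is \<open>2 * a = d\<close>. The position of \<open>f x\<close> half a turn away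
  no longer depends on \<open>f\<close>; this is what identifies two involutions.\<close>

lemma cyclic_on_commuting_involution:
  assumes "cyclic_on \<pi> X" "x \<in> X"
    and "\<And>y. y \<in> X \<Longrightarrow> f y \<in> X" "\<And>y. y \<in> X \<Longrightarrow> \<pi> (f y) = f (\<pi> y)"
    and "f (f x) = x" "f x \<noteq> x"
  shows "\<exists>a. 2 * a = funpow_dist1 \<pi> x x \<and> f x = (\<pi> ^^ a) x"
proof -
  define d where "d = funpow_dist1 \<pi> x x"
  have orbit: "X = orbit \<pi> x" and x: "x \<in> orbit \<pi> x"
    using assms(1,2) by (auto simp: cyclic_on_alldef)
  have in_X: "\<pi> z \<in> X" if "z \<in> X" for z
    using assms(1) that by (rule cyclic_on_inI)
  have "f x \<in> (\<lambda>j. (\<pi> ^^ j) x) ` {0..<d}"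
    using assms(2,3) orbit orbit_conv_funpow_dist1[OF x] by (simp add: d_def)
  then obtain a where a: "a < d" "f x = (\<pi> ^^ a) x"
    by auto
  have d: "(\<pi> ^^ d) x = x"
    unfolding d_def using x by (rule funpow_dist1_prop)
  have minimal: "(\<pi> ^^ j) x \<noteq> x" if "0 < j" "j < d" for j
    using that funpow_dist1_least[of j \<pi> x x] by (simp add: d_def)
  have "(\<pi> ^^ a) (f x) = f ((\<pi> ^^ a) x)"
    using assms(2,4) in_X by (intro funpow_commute_on[where X=X, symmetric]) auto
  then have "(\<pi> ^^ (a + a)) x = x"
    using a assms(5) by (simp add: funpow_add)
  have "a \<noteq> 0"
    using a assms(6) by (cases a) auto
  \<comment> \<open>The remainder \<open>a + a - d\<close> is below \<open>d\<close>, so being a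
    return time forces it to be 0.\<close>
  have "(\<pi> ^^ (a + a - d)) x = x" if "d \<le> a + a"
  proof -
    have "(\<pi> ^^ (a + a)) x = (\<pi> ^^ (a + a - d)) ((\<pi> ^^ d) x)"
      using that by (metis comp_apply funpow_add le_add_diff_inverse2)
    then show ?thesis
      using \<open>(\<pi> ^^ (a + a)) x = x\<close> d by simp
  qed
  then have "2 * a = d"
    using minimal[of "a + a"] minimal[of "a + a - d"] \<open>(\<pi> ^^ (a + a)) x = x\<close> \<open>a \<noteq> 0\<close> a(1)
    by (cases "a + a < d"; cases "a + a = d") auto
  then show ?thesis
    using a(2) d_def by blast
qed

text \<open>Interleave the cycles of \<open>\<sigma>\<close>: if \<open>x 0, \<dots>, x (m - 1)\<close> represent them,
  list the elements as \<open>x 0, \<dots>, x (m - 1), \<sigma> (x 0), \<dots>, \<sigma> (x (m - 1)), \<dots>\<close>; in this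
  cyclic order, \<open>\<sigma>\<close> is a shift by \<open>m\<close>.\<close>

lemma ex_cyclic_commuting:
  fixes \<sigma> :: "'a \<Rightarrow> 'a"
  assumes "finite X" "X \<noteq> {}" "\<sigma> permutes X" "k > 0"
    and period: "\<And>x. x \<in> X \<Longrightarrow> (\<sigma> ^^ k) x = x"
    and free: "\<And>x j. x \<in> X \<Longrightarrow> 0 < j \<Longrightarrow> j < k \<Longrightarrow> (\<sigma> ^^ j) x \<noteq> x"
  shows "\<exists>\<pi>. \<pi> permutes X \<and> cyclic_on \<pi> X \<and> (\<forall>x\<in>X. \<pi> (\<sigma> x) = \<sigma> (\<pi> x))"
proof -
  have perm: "permutation \<sigma>"
    using assms(1,3) by (auto simp: permutation_permutes)
  have orb: "orbit \<sigma> y = {(\<sigma> ^^ j) y | j. True}" for y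
    using perm by (rule orbit_altdef_permutation)
  have self: "y \<in> orbit \<sigma> y" for y
    using perm by (rule permutation_self_in_orbit)
  have orb_eq: "orbit \<sigma> y = orbit \<sigma> z" if "y \<in> orbit \<sigma> z" for y z
    using that self by (meson orbit_swap orbit_trans subsetI subset_antisym)
  \<comment> \<open>The chosen element depends on the orbit only, as a set, so it is the same for
    all members of one orbit.\<close>
  define rep where "rep y = (SOME z. z \<in> orbit \<sigma> y)" for y
  have rep: "rep y \<in> orbit \<sigma> y" for y
    unfolding rep_def using self by (rule someI)
  have rep_eq: "rep y = rep z" if "y \<in> orbit \<sigma> z" for y z
    using orb_eq[OF that] by (simp add: rep_def)
  have pow_in: "(\<sigma> ^^ j) y \<in> X" if "y \<in> X" for j y
    using that permutes_in_image[OF assms(3)] by (induction j) auto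
  have inj_pow: "(\<sigma> ^^ j) y = (\<sigma> ^^ j) z \<longleftrightarrow> y = z" for j y z
    using permutes_inj[OF assms(3)] inj_fn inj_eq by metis
  define R where "R = rep ` X"
  define m where "m = card R"
  have "finite R" "R \<noteq> {}"
    using assms(1,2) by (auto simp: R_def)
  have R: "R \<subseteq> X" "\<And>y. y \<in> R \<Longrightarrow> rep y = y"
  proof -
    show "R \<subseteq> X"
    proof
      fix z assume "z \<in> R"
      then obtain y j where "y \<in> X" "z = (\<sigma> ^^ j) y"
        using rep orb by (fastforce simp: R_def)
      then show "z \<in> X"
        using pow_in by simp
    qed
    show "rep y = y" if "y \<in> R" for y
      using that rep rep_eq by (auto simp: R_def)
  qed
  obtain x where x: "bij_betw x {0..<m} R"
    using ex_bij_betw_nat_finite[OF \<open>finite R\<close>] by (auto simp: m_def)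
  have "m > 0"
    using \<open>finite R\<close> \<open>R \<noteq> {}\<close> by (simp add: m_def card_gt_0_iff)
  \<comment> \<open>The interleaved list is indexed by all natural numbers and turns out to have
    period \<open>N = k * m\<close>; so the successor and the shift by \<open>m\<close> need no case
    distinction at the end of the list.\<close>
  define \<phi> where "\<phi> t = (\<sigma> ^^ (t div m)) (x (t mod m))" for t
  define N where "N = k * m"
  have "N > 0"
    using \<open>m > 0\<close> \<open>k > 0\<close> by (simp add: N_def)
  have x_R: "x i \<in> R" if "i < m" for i
    using that x by (auto simp: bij_betw_def)
  have x_X: "x (t mod m) \<in> X" for t
    using x_R[of "t mod m"] R(1) \<open>m > 0\<close> by auto
  have \<phi>_X: "\<phi> t \<in> X" for t
    using x_X pow_in by (simp add: \<phi>_def)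
  have shift: "\<phi> (t + m) = \<sigma> (\<phi> t)" for t
    using \<open>m > 0\<close> by (simp add: \<phi>_def div_add_self2)
  have \<phi>_N: "\<phi> (t + N) = \<phi> t" for t
  proof -
    have "\<phi> (t + j * m) = (\<sigma> ^^ j) (\<phi> t)" for j
    proof (induction j)
      case (Suc j)
      have "\<phi> (t + Suc j * m) = \<phi> (t + j * m + m)"
        by (simp add: algebra_simps)
      then show ?case
        using Suc shift by simp
    qed simp
    then show ?thesis
      using period \<phi>_X by (simp add: N_def)
  qed
  have \<phi>_mod: "\<phi> (t mod N) = \<phi> t" for t
  proof -
    have "\<phi> (s + j * N) = \<phi> s" for s j
    proof (induction j)
      case (Suc j)
      have "\<phi> (s + Suc j * N) = \<phi> (s + j * N + N)"
        by (simp add: algebra_simps)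
      then show ?case
        using Suc \<phi>_N by simp
    qed simp
    from this[of "t mod N" "t div N"] show ?thesis
      by simp
  qed
  have free': "a = b" if "(\<sigma> ^^ a) y = (\<sigma> ^^ b) y" "y \<in> X" "a \<le> b" "b < k" for a b y
  proof -
    have "(\<sigma> ^^ a) y = (\<sigma> ^^ a) ((\<sigma> ^^ (b - a)) y)"
      using that by (metis comp_apply funpow_add le_add_diff_inverse)
    then have "(\<sigma> ^^ (b - a)) y = y"
      by (simp add: inj_pow)
    then show ?thesis
      using free[of y "b - a"] that by fastforce
  qed
  \<comment> \<open>The orbit of an entry reveals \<open>t mod m\<close>, and freeness within that
    orbit then reveals \<open>t div m\<close>.\<close>
  have inj: "inj_on \<phi> {..<N}"
  proof (rule inj_onI)
    fix s t assume st: "s \<in> {..<N}" "t \<in> {..<N}" "\<phi> s = \<phi> t"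
    have rep_\<phi>: "rep (\<phi> t) = x (t mod m)" for t
    proof -
      have "\<phi> t \<in> orbit \<sigma> (x (t mod m))"
        by (auto simp: \<phi>_def orb)
      then show ?thesis
        using rep_eq R(2)[OF x_R] \<open>m > 0\<close> by simp
    qed
    then have "x (s mod m) = x (t mod m)"
      using st(3) by metis
    then have *: "s mod m = t mod m"
      using x \<open>m > 0\<close> by (auto simp: bij_betw_def inj_on_def)
    have "s div m < k" "t div m < k"
      using st(1,2) by (auto simp: N_def less_mult_imp_div_less)
    then have "s div m = t div m"
      using st(3) * free'[OF _ x_X[of t], of "s div m" "t div m"]
        free'[OF _ x_X[of t], of "t div m" "s div m"]
      by (simp add: \<phi>_def) linarith
    with * show "s = t"
      by (metis div_mult_mod_eq)
  qed
  have surj: "\<phi> ` {..<N} = X"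
  proof
    show "\<phi> ` {..<N} \<subseteq> X"
      using \<phi>_X by auto
    show "X \<subseteq> \<phi> ` {..<N}"
    proof
      fix y assume "y \<in> X"
      then have "rep y \<in> R"
        by (simp add: R_def)
      then obtain i where i: "i < m" "rep y = x i"
        using x by (auto simp: bij_betw_def)
      have "y \<in> orbit \<sigma> (rep y)"
        using orb_eq[OF rep] self by metis
      then obtain j where "y = (\<sigma> ^^ j) (x i)"
        using i by (auto simp: orb)
      then have "y = \<phi> (i + j * m)"
        using i by (simp add: \<phi>_def)
      then have "y = \<phi> ((i + j * m) mod N)"
        using \<phi>_mod by simp
      then show "y \<in> \<phi> ` {..<N}"
        using \<open>N > 0\<close> by auto
    qed
  qed
  define \<pi> where "\<pi> y = (if y \<in> X then \<phi> (Suc (inv_into {..<N} \<phi> y)) else y)" for y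
  have \<pi>_\<phi>: "\<pi> (\<phi> t) = \<phi> (Suc t)" for t
  proof -
    have "inv_into {..<N} \<phi> (\<phi> (t mod N)) = t mod N"
      using inj \<open>N > 0\<close> by (simp add: inv_into_f_f)
    then have "\<pi> (\<phi> t) = \<phi> (Suc (t mod N))"
      using \<phi>_X by (simp add: \<pi>_def \<phi>_mod)
    also have "\<dots> = \<phi> (Suc t)"
      using \<phi>_mod[of "Suc (t mod N)"] \<phi>_mod[of "Suc t"] by (simp add: mod_Suc_eq)
    finally show ?thesis .
  qed
  have \<pi>_pow: "(\<pi> ^^ j) (\<phi> t) = \<phi> (t + j)" for j t
    by (induction j) (auto simp: \<pi>_\<phi>)
  have "\<pi> ` X = X"
  proof
    show "\<pi> ` X \<subseteq> X"
      using \<phi>_X by (auto simp: \<pi>_def)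
    show "X \<subseteq> \<pi> ` X"
    proof
      fix y assume "y \<in> X"
      then obtain t where "y = \<phi> t"
        using surj by (metis imageE)
      \<comment> \<open>Adding one period supplies a predecessor even for
        \<open>t = 0\<close>.\<close>
      then have "y = \<pi> (\<phi> (t + N - 1))"
        using \<pi>_\<phi> \<phi>_N \<open>N > 0\<close> by simp
      then show "y \<in> \<pi> ` X"
        using \<phi>_X by blast
    qed
  qed
  then have "bij_betw \<pi> X X"
    using assms(1) by (simp add: bij_betw_def eq_card_imp_inj_on)
  then have "\<pi> permutes X"
    by (rule bij_imp_permutes) (simp add: \<pi>_def)
  moreover have "cyclic_on \<pi> X"
  proof (rule cyclic_on_singleI)
    show "\<phi> 0 \<in> X"
      by (rule \<phi>_X)
    have "orbit \<pi> (\<phi> 0) = {\<phi> t | t. t > 0}"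
      by (simp add: orbit_altdef \<pi>_pow)
    also have "\<dots> = X"
    proof -
      \<comment> \<open>An \<open>orbit\<close> consists of the iterates with positive exponent, so
        index 0 is replaced by the equivalent index \<open>N\<close>.\<close>
      have "\<phi> t \<in> {\<phi> t | t. t > 0}" for t
        using \<phi>_N[of t] \<open>N > 0\<close> by (auto intro!: exI[of _ "t + N"])
      then show ?thesis
        using surj \<phi>_X by blast
    qed
    finally show "X = orbit \<pi> (\<phi> 0)"
      by simp
  qed
  moreover have "\<pi> (\<sigma> y) = \<sigma> (\<pi> y)" if "y \<in> X" for y
  proof -
    obtain t where "y = \<phi> t"
      using surj \<open>y \<in> X\<close> by blast
    then show ?thesis
      using \<pi>_\<phi> shift by (metis add_Suc)
  qed
  ultimately show ?thesis
    by blast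
qed

section \<open>Isometries and line reflections of the complex plane\<close>

lemma orthogonal_transformation_mult:
  assumes "norm u = 1"
  shows "orthogonal_transformation (\<lambda>z::complex. u * z)"
  using assms by (simp add: orthogonal_transformation linear_iff norm_mult algebra_simps)

lemma orthogonal_transformation_mult_cnj:
  assumes "norm u = 1"
  shows "orthogonal_transformation (\<lambda>z. u * cnj z)"
  using assms by (simp add: orthogonal_transformation linear_iff norm_mult algebra_simps)

lemma norm_one_mult_cnj:
  assumes "norm u = 1"
  shows "u * cnj u = 1" "cnj u * u = 1"
  using assms complex_norm_square[of u] by (simp_all add: mult.commute)

text \<open>Put \<open>u = f 1\<close>. The quotient \<open>w\<close> of \<open>f \<i>\<close> by
  \<open>u\<close> has norm 1, and the orthogonality of \<open>f 1\<close> and \<open>f \<i>\<close>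
  makes it purely imaginary, so it is \<i> or its negative. This sign decides between a rotation and
  a reflection, and linearity gives the rest.\<close>

lemma orthogonal_transformation_complex:
  assumes "orthogonal_transformation (f :: complex \<Rightarrow> complex)"
  obtains u where "norm u = 1" "f = (\<lambda>z. u * z) \<or> f = (\<lambda>z. u * cnj z)"
proof -
  define u where "u = f 1"
  define w where "w = f \<i> * cnj u"
  have lin: "linear f" and nrm: "norm (f z) = norm z" for z
    using assms by (simp_all add: orthogonal_transformation)
  have u: "norm u = 1"
    by (simp add: u_def nrm)
  have f\<i>: "f \<i> = w * u"
    using norm_one_mult_cnj[OF u] by (simp add: w_def)
  have "norm w = 1"
    by (simp add: w_def norm_mult nrm u)
  moreover have "inner (f 1) (f \<i>) = 0"
    using assms by (simp add: orthogonal_transformation_def inner_complex_def)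
  then have "Re w = 0"
    by (simp add: w_def u_def inner_complex_def mult.commute)
  ultimately have w: "w = \<i> \<or> w = - \<i>"
    by (auto simp: complex_eq_iff norm_complex_def)
  have f: "f z = (of_real (Re z) + of_real (Im z) * w) * u" for z
  proof -
    have "f z = f (Re z *\<^sub>R 1 + Im z *\<^sub>R \<i>)"
      by (rule arg_cong[of _ _ f]) (simp add: complex_eq_iff)
    also have "\<dots> = Re z *\<^sub>R f 1 + Im z *\<^sub>R f \<i>"
      by (simp only: linear_add[OF lin] linear_scale[OF lin])
    finally show ?thesis
      by (simp add: f\<i> scaleR_conv_of_real algebra_simps flip: u_def)
  qed
  have "f = (\<lambda>z. u * z) \<or> f = (\<lambda>z. u * cnj z)"
    using w
  proof
    assume "w = \<i>"
    then have "f z = u * z" for z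
      using complex_eq[of z] by (simp add: f mult.commute)
    then show ?thesis by auto
  next
    assume "w = - \<i>"
    then have "f z = u * cnj z" for z
      using complex_eq[of "cnj z"] by (simp add: f mult.commute)
    then show ?thesis by auto
  qed
  with u that show thesis by blast
qed

section \<open>Lines and their reflections in complex coordinates\<close>

lemma is_line_range:
  assumes "norm v = 1"
  shows "is_line (range (\<lambda>t. a + of_real t * v))"
proof -
  have "range (\<lambda>t. a + of_real t * v) = affine hull {a, a + v}"
    by (simp add: affine_hull_2_alt scaleR_conv_of_real)
  moreover have "a \<noteq> a + v"
    using assms by auto
  ultimately show ?thesis
    by (simp add: is_line_def del: add_left_cancel)
qed

lemma is_lineE:
  assumes "is_line L"
  obtains a v where "norm v = 1" "L = range (\<lambda>t. a + of_real t * v)"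
proof -
  obtain B where B: "\<not> affine_dependent B" "affine hull B = affine hull L"
    "of_nat (card B) = aff_dim L + 1"
    using aff_dim_basis_exists by blast
  then have "card B = 2"
    using assms by (simp add: is_line_def)
  then obtain a b where ab: "B = {a, b}" "a \<noteq> b"
    by (auto simp: card_2_iff)
  have L: "L = range (\<lambda>t. a + t *\<^sub>R (b - a))"
    using B(2) ab assms unfolding is_line_def by (metis affine_hull_2_alt affine_hull_eq)
  define d v where "d = norm (b - a)" and "v = (b - a) / of_real d"
  have d: "d \<noteq> 0"
    using ab by (simp add: d_def)
  have "range (\<lambda>t. a + t *\<^sub>R (b - a)) = range (\<lambda>t. a + of_real t * v)"
  proof -
    have "a + t *\<^sub>R (b - a) = a + of_real (t * d) * v"
      "a + of_real t * v = a + (t / d) *\<^sub>R (b - a)" for t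
      using d by (simp_all add: v_def scaleR_conv_of_real)
    then show ?thesis
      by (metis (no_types, lifting) image_subset_iff rangeI subset_antisym)
  qed
  moreover have "norm v = 1"
    using d by (simp add: v_def d_def norm_divide)
  ultimately show thesis
    using that L by blast
qed

text \<open>Subtracting \<open>a\<close> and multiplying by \<open>cnj v\<close> is an isometry that
  takes the line to the real axis, where the closest point is the real part.\<close>

lemma closest_point_line:
  assumes "norm v = 1"
  shows "closest_point (range (\<lambda>t. a + of_real t * v)) z = a + of_real (Re ((z - a) * cnj v)) * v"
    (is "closest_point ?L z = ?x")
proof (rule closest_point_unique[symmetric])
  have "affine ?L"
    using is_line_range[OF assms] by (simp add: is_line_def)
  then show "convex ?L" "closed ?L"
    by (simp_all add: affine_imp_convex affine_closed)
  show "?x \<in> ?L" by blast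
  have dist_eq: "dist z (a + of_real t * v) = norm ((z - a) * cnj v - of_real t)" for t
  proof -
    have "z - (a + of_real t * v) = ((z - a) * cnj v - of_real t) * v"
      using norm_one_mult_cnj[OF assms] by (simp add: algebra_simps)
    then show ?thesis
      using assms by (simp add: dist_norm norm_mult)
  qed
  have "norm (w - of_real (Re w)) \<le> norm (w - of_real t)" for w and t :: real
  proof -
    have "w - of_real (Re w) = \<i> * of_real (Im w)"
      by (simp add: complex_eq_iff)
    then show ?thesis
      using abs_Im_le_cmod[of "w - of_real t"] by (simp add: norm_mult)
  qed
  then show "\<forall>y\<in>?L. dist z ?x \<le> dist z y"
    unfolding ball_simps dist_eq by blast
qed

text \<open>In the coordinate \<open>w\<close> the line is the real axis and the reflection is
  conjugation. Going back contributes one factor \<open>v\<close>, and conjugating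
  \<open>cnj v\<close> contributes the other.\<close>

lemma reflection_in_range:
  assumes "norm v = 1"
  shows "reflection_in (range (\<lambda>t. a + of_real t * v)) z = a + v\<^sup>2 * cnj (z - a)"
proof -
  define w where "w = (z - a) * cnj v"
  have z: "z = a + w * v"
    using norm_one_mult_cnj[OF assms] by (simp add: w_def algebra_simps)
  have "reflection_in (range (\<lambda>t. a + of_real t * v)) z = a + (2 * of_real (Re w) - w) * v"
    using z unfolding reflection_in_def closest_point_line[OF assms] w_def[symmetric]
    by (simp add: scaleR_conv_of_real algebra_simps)
  also have "2 * of_real (Re w) - w = cnj w"
    by (simp add: complex_eq_iff)
  finally show ?thesis
    by (simp add: w_def power2_eq_square algebra_simps)
qed

lemma reflection_inE:
  assumes "is_line L"
  obtains a u where "norm u = 1" "\<And>z. reflection_in L z = a + u * cnj (z - a)"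
proof -
  obtain a v where v: "norm v = 1" "L = range (\<lambda>t. a + of_real t * v)"
    using is_lineE[OF assms] by blast
  from v(1) have "norm (v\<^sup>2) = 1"
    by (simp add: norm_power)
  with that reflection_in_range[OF v(1)] v(2) show thesis
    by blast
qed

text \<open>A line with direction \<open>v\<close> reflects with factor \<open>v\<^sup>2\<close>, so
  its direction has to be a square root of \<open>u\<close>.\<close>

lemma ex_line_reflection:
  assumes "norm u = 1"
  obtains L where "is_line L" "\<And>z. reflection_in L z = a + u * cnj (z - a)"
proof -
  have "(norm (csqrt u))\<^sup>2 = 1"
    by (metis assms norm_power power2_csqrt)
  then have v: "norm (csqrt u) = 1"
    by (simp add: power2_eq_1_iff)
  show thesis
    using that is_line_range[OF v, of a] reflection_in_range[OF v, of a] by simp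
qed

lemma reflection_in_fixed_iff:
  assumes "is_line L"
  shows "reflection_in L z = z \<longleftrightarrow> z \<in> L"
proof -
  have "closed L" "L \<noteq> {}"
    using assms by (auto simp: is_line_def affine_closed)
  have "reflection_in L z = z \<longleftrightarrow> closest_point L z = z"
    by (auto simp: reflection_in_def scaleR_2)
  also have "\<dots> \<longleftrightarrow> z \<in> L"
    using closest_point_in_set[OF \<open>closed L\<close> \<open>L \<noteq> {}\<close>, of z] closest_point_self[of z L] by auto
  finally show ?thesis .
qed

lemma reflection_in_involution:
  assumes "is_line L"
  shows "reflection_in L (reflection_in L z) = z"
proof -
  obtain a u where u: "norm u = 1" "\<And>z. reflection_in L z = a + u * cnj (z - a)"
    using reflection_inE[OF assms] by blast
  have "reflection_in L (reflection_in L z) = a + (u * cnj u) * (z - a)"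
    by (simp only: u(2) add_diff_cancel_left' complex_cnj_mult complex_cnj_cnj mult.assoc)
  then show ?thesis
    by (simp only: norm_one_mult_cnj[OF u(1)]) simp
qed

text \<open>A point off the axis and its mirror image determine the axis, as their perpendicular
  bisector. Algebraically, they determine the factor \<open>u\<close> of the reflection and hence
  the whole map, whose fixed points form the line.\<close>

lemma reflection_in_eqI:
  assumes "is_line L" "is_line L'" "reflection_in L p = reflection_in L' p" "p \<notin> L"
  shows "L = L'"
proof -
  define q where "q = reflection_in L p"
  have "p \<noteq> q"
    using assms(1,4) reflection_in_fixed_iff unfolding q_def by metis
  have eq: "reflection_in M z = q - (p - q) / cnj (q - p) * cnj (p - z)"
    if "is_line M" "reflection_in M p = q" for M z
  proof -
    obtain a u where u: "norm u = 1" "\<And>z. reflection_in M z = a + u * cnj (z - a)"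
      using reflection_inE[OF \<open>is_line M\<close>] by blast
    have "reflection_in M q = p"
      using that reflection_in_involution by metis
    then have p: "p = a + u * cnj (q - a)"
      using u(2)[of q] by (rule trans[OF sym])
    have q: "q = a + u * cnj (p - a)"
      using that(2) u(2)[of p] by (rule trans[OF sym])
    \<comment> \<open>The reflection exchanges \<open>p\<close> and \<open>q\<close>; subtracting
      the two equations eliminates the base point \<open>a\<close>.\<close>
    have "p - q = u * cnj (q - p)"
      by (subst (1) p, subst (2) q) (simp add: algebra_simps)
    moreover have "cnj (q - p) \<noteq> 0"
      using \<open>p \<noteq> q\<close> by (simp only: complex_cnj_zero_iff) simp
    ultimately have "u = (p - q) / cnj (q - p)"
      by simp
    moreover have "reflection_in M z = q - u * cnj (p - z)"
      by (subst q) (simp add: u(2) algebra_simps)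
    ultimately show ?thesis
      by simp
  qed
  have "reflection_in L z = reflection_in L' z" for z
    unfolding eq[OF assms(1) q_def[symmetric]] eq[OF assms(2) assms(3)[symmetric, folded q_def]] ..
  then show ?thesis
    by (simp add: set_eq_iff flip: reflection_in_fixed_iff[OF assms(1)] reflection_in_fixed_iff[OF assms(2)])
qed

section \<open>Algorithms as cycles commuting with all symmetries\<close>

lemma local_frame_orthogonal:
  assumes "orthogonal_transformation f"
  shows "local_frame f"
  unfolding local_frame_def using assms by (intro exI[of _ 1] exI[of _ f]) simp

lemma local_frameE:
  assumes "local_frame T"
  obtains c where "c > 0" "linear T" "bij T" "\<And>z. norm (T z) = c * norm z"
proof -
  obtain u f where u: "u > 0" and f: "orthogonal_transformation f" and T: "T = (\<lambda>v. f v /\<^sub>R u)"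
    using assms by (auto simp: local_frame_def)
  have "linear T"
    using linear_compose_scale_right[of f "inverse u"] f by (simp add: T orthogonal_transformation)
  moreover have nrm: "norm (T z) = inverse u * norm z" for z
    using u f by (simp add: T orthogonal_transformation)
  moreover have "inj T"
    using \<open>linear T\<close> nrm u by (simp add: linear_injective_0) (metis inverse_nonzero_iff_nonzero mult_eq_0_iff norm_eq_zero less_irrefl)
  then have "bij T"
    using \<open>linear T\<close> by (simp add: bij_def linear_injective_imp_surjective)
  ultimately show thesis
    using that[of "inverse u"] u by simp
qed

text \<open>Isometries are recorded through their action on robot indices: only this action can be
  compared with the cycle \<pi>, and isometries that agree on all robots become one element.\<close>

definition symmetries :: "nat \<Rightarrow> config \<Rightarrow> (nat \<Rightarrow> nat) set" where
  "symmetries n C = {\<sigma>. \<sigma> permutes {..<n} \<and>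
     (\<exists>a f. orthogonal_transformation f \<and> (\<forall>i<n. C (\<sigma> i) = a + f (C i)))}"

lemma symmetries_permutes: "\<sigma> \<in> symmetries n C \<Longrightarrow> \<sigma> permutes {..<n}"
  by (simp add: symmetries_def)

lemma permutation_of_image_points:
  assumes "inj_on C {..<n}" "g ` points n C = points n C"
  obtains \<sigma> where "\<sigma> permutes {..<n}" "\<And>i. i < n \<Longrightarrow> C (\<sigma> i) = g (C i)"
proof -
  define \<sigma> where "\<sigma> i = (if i < n then inv_into {..<n} C (g (C i)) else i)" for i
  have *: "g (C i) \<in> C ` {..<n}" if "i < n" for i
    using that assms(2) by (auto simp: points_def)
  have \<sigma>: "C (\<sigma> i) = g (C i)" "\<sigma> i < n" if "i < n" for i
    using that f_inv_into_f[OF *[OF that]] inv_into_into[OF *[OF that]] by (simp_all add: \<sigma>_def)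
  have "\<sigma> ` {..<n} = {..<n}"
  proof
    show "\<sigma> ` {..<n} \<subseteq> {..<n}"
      using \<sigma> by auto
    show "{..<n} \<subseteq> \<sigma> ` {..<n}"
    proof
      fix j assume j: "j \<in> {..<n}"
      then have "C j \<in> g ` points n C"
        unfolding assms(2) by (simp add: points_def)
      then obtain i where i: "i < n" "C j = g (C i)"
        by (auto simp: points_def)
      then have "j = \<sigma> i"
        using assms(1) \<sigma>[OF i(1)] j by (auto simp: inj_on_def)
      with i(1) show "j \<in> \<sigma> ` {..<n}"
        by simp
    qed
  qed
  then have "bij_betw \<sigma> {..<n} {..<n}"
    by (simp add: bij_betw_def eq_card_imp_inj_on)
  then have "\<sigma> permutes {..<n}"
    by (rule bij_imp_permutes) (simp add: \<sigma>_def)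
  with \<sigma>(1) that show thesis by blast
qed

lemma snapshot_altdef:
  "snapshot n T C p = image_mset (\<lambda>j. T (C j - p)) (mset_set {..<n})"
  by (simp add: snapshot_def points_mset_def image_mset.compositionality comp_def)

text \<open>All other robots leave exactly one free point, so the destination of a robot does not
  depend on its frame. A symmetry then turns the view of a robot into the view of another one.\<close>

lemma solves_imp_commuting:
  assumes "solves_visit_all_1_step n A C" and inj: "inj_on C {..<n}"
  obtains \<pi> where "\<pi> \<in> n_cycles n"
    "\<And>\<sigma> i. \<sigma> \<in> symmetries n C \<Longrightarrow> i < n \<Longrightarrow> \<pi> (\<sigma> i) = \<sigma> (\<pi> i)"
proof -
  define dest where "dest T i = C i + inv T (A (snapshot n T C (C i)))" for T i
  have step: "\<exists>\<pi>\<in>n_cycles n. \<forall>i<n. dest (Z i) i = C (\<pi> i)" if Z: "\<forall>i<n. local_frame (Z i)" for Z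
  proof -
    obtain \<pi> where \<pi>: "\<pi> \<in> n_cycles n" "\<And>t i. i < n \<Longrightarrow> run n A Z C t i = C ((\<pi> ^^ t) i)"
      using assms(1) Z unfolding solves_visit_all_1_step_def by blast
    have "dest (Z i) i = C (\<pi> i)" if "i < n" for i
      using \<pi>(2)[OF that, of 1] by (simp add: run_def fsync_round_def dest_def)
    with \<pi>(1) show ?thesis by blast
  qed
  obtain \<pi> where \<pi>: "\<pi> \<in> n_cycles n" "\<And>i. i < n \<Longrightarrow> dest (\<lambda>x. x) i = C (\<pi> i)"
    using step[of "\<lambda>_ x. x"] by (auto simp: local_frame_orthogonal)
  have perm: "\<pi> permutes {..<n}"
    using \<pi>(1) by (simp add: n_cycles_def)
  have dest: "dest T i = C (\<pi> i)" if T: "local_frame T" and i: "i < n" for T i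
  proof -
    \<comment> \<open>Only the frame of robot \<open>i\<close> is changed from the reference run
      with identity frames. The other robots keep their destinations, so the one point left over for
      \<open>i\<close> is also the same.\<close>
    obtain \<pi>' where \<pi>': "\<pi>' \<in> n_cycles n" "\<And>j. j < n \<Longrightarrow> dest (((\<lambda>_ x. x)(i := T)) j) j = C (\<pi>' j)"
    proof -
      have "\<forall>j<n. local_frame (((\<lambda>_ x. x)(i := T)) j)"
        using T by (simp add: local_frame_orthogonal)
      then show thesis
        using step that by blast
    qed
    have perm': "\<pi>' permutes {..<n}"
      using \<pi>'(1) by (simp add: n_cycles_def)
    have "\<pi>' j = \<pi> j" if "j < n" "j \<noteq> i" for j
    proof -
      have "C (\<pi>' j) = C (\<pi> j)"
        using \<pi>'(2)[of j] \<pi>(2)[of j] that by simp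
      then show ?thesis
        using inj permutes_in_image[OF perm, of j] permutes_in_image[OF perm', of j] that
        by (auto simp: inj_on_def)
    qed
    then have "\<pi>' ` ({..<n} - {i}) = \<pi> ` ({..<n} - {i})"
      by (intro image_cong) auto
    then have "{..<n} - {\<pi>' i} = {..<n} - {\<pi> i}"
      by (simp add: image_set_diff[OF permutes_inj[OF perm]] image_set_diff[OF permutes_inj[OF perm']]
          permutes_image[OF perm] permutes_image[OF perm'])
    moreover have "\<pi>' i < n" "\<pi> i < n"
      using permutes_in_image[OF perm, of i] permutes_in_image[OF perm', of i] i by auto
    ultimately have "\<pi>' i = \<pi> i"
      by blast
    then show ?thesis
      using \<pi>'(2)[OF i] by simp
  qed
  have "\<pi> (\<sigma> i) = \<sigma> (\<pi> i)" if \<sigma>: "\<sigma> \<in> symmetries n C" and i: "i < n" for \<sigma> i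
  proof -
    obtain a f where f: "orthogonal_transformation f" and af: "\<And>j. j < n \<Longrightarrow> C (\<sigma> j) = a + f (C j)"
      and p: "\<sigma> permutes {..<n}"
      using \<sigma> by (auto simp: symmetries_def)
    have "linear f" "bij f"
      using f by (simp_all add: orthogonal_transformation_linear orthogonal_transformation_bij)
    have less: "\<sigma> j < n" "\<pi> j < n" if "j < n" for j
      using permutes_in_image[OF p, of j] permutes_in_image[OF perm, of j] that by auto
    \<comment> \<open>With frame \<open>inv f\<close>, robot \<open>\<sigma> i\<close> sees exactly
      what robot \<open>i\<close> sees in the identity frame: reindexing by \<sigma> introduces an
      \<open>f\<close> that the frame cancels.\<close>
    have "snapshot n (inv f) C (C (\<sigma> i)) = image_mset (\<lambda>j. inv f (C j - C (\<sigma> i))) (image_mset \<sigma> (mset_set {..<n}))"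
      using permutes_inj_on[OF p] permutes_image[OF p] by (simp add: snapshot_altdef image_mset_mset_set)
    also have "\<dots> = image_mset (\<lambda>j. C j - C i) (mset_set {..<n})"
      unfolding image_mset.compositionality comp_def
    proof (rule image_mset_cong)
      fix j assume "j \<in># mset_set {..<n}"
      then have "C (\<sigma> j) - C (\<sigma> i) = f (C j - C i)"
        using i \<open>linear f\<close> by (simp add: af linear_diff)
      then show "inv f (C (\<sigma> j) - C (\<sigma> i)) = C j - C i"
        using \<open>bij f\<close> by (simp add: bij_is_inj)
    qed
    finally have snap: "snapshot n (inv f) C (C (\<sigma> i)) = snapshot n (\<lambda>x. x) C (C i)"
      by (simp add: snapshot_altdef)
    have "inv (\<lambda>x::complex. x) = (\<lambda>x. x)"
      using inv_id by (simp add: id_def)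
    then have d: "A (snapshot n (\<lambda>x. x) C (C i)) = C (\<pi> i) - C i"
      using \<pi>(2)[OF i] by (simp add: dest_def algebra_simps)
    have "C (\<pi> (\<sigma> i)) = dest (inv f) (\<sigma> i)"
      using f less i by (simp add: dest local_frame_orthogonal orthogonal_transformation_inv)
    also have "\<dots> = a + f (C i) + f (C (\<pi> i) - C i)"
      unfolding dest_def snap d using \<open>bij f\<close> i by (simp add: af inv_inv_eq)
    also have "\<dots> = C (\<sigma> (\<pi> i))"
      using \<open>linear f\<close> i less by (simp add: af linear_diff)
    finally show ?thesis
      using inj less i by (auto simp: inj_on_def)
  qed
  with \<pi>(1) that show thesis by blast
qed

text \<open>Equal views are related by a similarity that permutes the robots; it is an isometry
  because it preserves the sum of all mutual distances.\<close>

lemma snapshot_eq_imp_symmetry: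
  assumes inj: "inj_on C {..<n}" and "n \<ge> 2" "i < n" "j < n"
    and T: "local_frame T" and T': "local_frame T'"
    and eq: "snapshot n T C (C i) = snapshot n T' C (C j)"
  obtains \<sigma> where "\<sigma> \<in> symmetries n C" "\<sigma> i = j"
    "\<And>l. l < n \<Longrightarrow> T (C l - C i) = T' (C (\<sigma> l) - C j)"
proof -
  obtain c where c: "c > 0" "linear T" "bij T" "\<And>z. norm (T z) = c * norm z"
    using local_frameE[OF T] by blast
  obtain c' where c': "c' > 0" "linear T'" "bij T'" "\<And>z. norm (T' z) = c' * norm z"
    using local_frameE[OF T'] by blast
  \<comment> \<open>In global coordinates, \<open>f\<close> is the linear part of the similarity
    \<open>g\<close> that carries the view from robot \<open>i\<close> onto the view from robot
    \<open>j\<close>.\<close>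
  define f where "f = inv T' \<circ> T"
  have T'_f: "T' (f z) = T z" for z
    using c'(3) by (simp add: f_def bij_is_surj surj_f_inv_f)
  have "linear f"
    unfolding f_def using c(2) c'(2,3)
    by (intro linear_compose inj_linear_imp_inv_linear) (auto simp: bij_is_inj)
  define g where "g z = C j + f (z - C i)" for z
  have set_eq: "(\<lambda>l. T (C l - C i)) ` {..<n} = (\<lambda>l. T' (C l - C j)) ` {..<n}"
    using arg_cong[OF eq, of set_mset] by (simp add: snapshot_altdef)
  have "g ` points n C = (\<lambda>w. C j + inv T' w) ` (\<lambda>l. T (C l - C i)) ` {..<n}"
    by (simp add: points_def image_image g_def f_def)
  also have "\<dots> = points n C"
    using c'(3) unfolding set_eq by (simp add: points_def image_image bij_is_inj)
  finally obtain \<sigma> where \<sigma>: "\<sigma> permutes {..<n}" "\<And>l. l < n \<Longrightarrow> C (\<sigma> l) = g (C l)"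
    using permutation_of_image_points[OF inj] by blast
  have less: "\<sigma> l < n" if "l < n" for l
    using permutes_in_image[OF \<sigma>(1), of l] that by auto
  have T_eq: "T (C l - C i) = T' (C (\<sigma> l) - C j)" if "l < n" for l
    using that by (simp add: \<sigma>(2) g_def T'_f)
  have "C (\<sigma> i) = C j"
    using \<open>i < n\<close> \<open>linear f\<close> by (simp add: \<sigma>(2) g_def linear_0)
  then have "\<sigma> i = j"
    using inj less assms(3,4) by (auto simp: inj_on_def)
  define D where "D = (\<Sum>l<n. \<Sum>k<n. norm (C l - C k))"
  have "c * norm (C l - C k) = c' * norm (C (\<sigma> l) - C (\<sigma> k))" if "l < n" "k < n" for l k
  proof -
    have "C (\<sigma> l) - C (\<sigma> k) = f (C l - C k)"
      using that \<open>linear f\<close> by (simp add: \<sigma>(2) g_def linear_diff)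
    then show ?thesis
      by (simp add: T'_f flip: c(4) c'(4))
  qed
  then have "c * D = c' * (\<Sum>l<n. \<Sum>k<n. norm (C (\<sigma> l) - C (\<sigma> k)))"
    by (simp add: D_def sum_distrib_left)
  also have "(\<Sum>l<n. \<Sum>k<n. norm (C (\<sigma> l) - C (\<sigma> k))) = D"
  proof -
    have "(\<Sum>k<n. norm (C (\<sigma> l) - C (\<sigma> k))) = (\<Sum>k<n. norm (C (\<sigma> l) - C k))" for l
      using sum.permute[OF \<sigma>(1), of "\<lambda>k. norm (C (\<sigma> l) - C k)"] by (simp add: comp_def)
    then show ?thesis
      using sum.permute[OF \<sigma>(1), of "\<lambda>l. \<Sum>k<n. norm (C l - C k)"] by (simp add: D_def comp_def)
  qed
  finally have "c * D = c' * D" .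
  moreover have "D > 0"
  proof -
    have "0 < norm (C 0 - C 1)"
      using inj_onD[OF inj, of 0 1] \<open>n \<ge> 2\<close> by auto
    also have "\<dots> \<le> (\<Sum>k<n. norm (C 0 - C k))"
      using \<open>n \<ge> 2\<close> by (intro member_le_sum) auto
    also have "\<dots> \<le> D"
      unfolding D_def using \<open>n \<ge> 2\<close>
      by (intro member_le_sum[of 0 _ "\<lambda>l. \<Sum>k<n. norm (C l - C k)"]) (auto intro: sum_nonneg)
    finally show ?thesis .
  qed
  ultimately have "c = c'"
    by simp
  then have "norm (f z) = norm z" for z
    using c(1) c(4)[of z] c'(4)[of "f z"] by (simp add: T'_f)
  then have f: "orthogonal_transformation f"
    using \<open>linear f\<close> by (simp add: orthogonal_transformation)
  have "C (\<sigma> l) = (C j - f (C i)) + f (C l)" if "l < n" for l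
    using that \<open>linear f\<close> by (simp add: \<sigma>(2) g_def linear_diff)
  with f \<sigma>(1) have "\<sigma> \<in> symmetries n C"
    unfolding symmetries_def by blast
  with \<open>\<sigma> i = j\<close> T_eq that show thesis by blast
qed

text \<open>The algorithm matches its snapshot with some robot and frame in the configuration
  \<open>C\<close> and makes the move that \<pi> prescribes there. Different matches differ by a
  symmetry, and commutation with \<pi> makes the resulting local destinations equal, so any choice
  will do.\<close>

lemma commuting_imp_solvable:
  assumes inj: "inj_on C {..<n}" and "n \<ge> 2" and \<pi>: "\<pi> \<in> n_cycles n"
    and comm: "\<And>\<sigma> i. \<sigma> \<in> symmetries n C \<Longrightarrow> i < n \<Longrightarrow> \<pi> (\<sigma> i) = \<sigma> (\<pi> i)"
  shows "visit_all_solvable_1_step n C"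
proof -
  define P where "P M d \<longleftrightarrow> (\<exists>T i. local_frame T \<and> i < n \<and> M = snapshot n T C (C i)
    \<and> d = T (C (\<pi> i) - C i))" for M d
  define A where "A M = (SOME d. P M d)" for M
  have perm: "\<pi> permutes {..<n}"
    using \<pi> by (simp add: n_cycles_def)
  have less: "\<pi> i < n" if "i < n" for i
    using permutes_in_image[OF perm, of i] that by auto
  have A: "A (snapshot n T C (C i)) = T (C (\<pi> i) - C i)" if T: "local_frame T" and i: "i < n" for T i
  proof -
    have "P (snapshot n T C (C i)) (T (C (\<pi> i) - C i))"
      using that by (auto simp: P_def)
    then have "P (snapshot n T C (C i)) (A (snapshot n T C (C i)))"
      unfolding A_def by (rule someI)
    then obtain T' j where T': "local_frame T'" "j < n" "snapshot n T C (C i) = snapshot n T' C (C j)"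
      "A (snapshot n T C (C i)) = T' (C (\<pi> j) - C j)"
      unfolding P_def by blast
    obtain \<sigma> where \<sigma>: "\<sigma> \<in> symmetries n C" "\<sigma> i = j"
      "\<And>l. l < n \<Longrightarrow> T (C l - C i) = T' (C (\<sigma> l) - C j)"
      using snapshot_eq_imp_symmetry[OF inj \<open>n \<ge> 2\<close> i T'(2) T T'(1,3)] by blast
    then show ?thesis
      using T'(4) comm[OF \<sigma>(1) i] \<sigma>(3)[OF less[OF i]] by simp
  qed
  have "run n A Z C t i = C ((\<pi> ^^ t) i)" if Z: "\<forall>i<n. local_frame (Z i)" and "i < n" for Z t i
    using \<open>i < n\<close>
  proof (induction t arbitrary: i)
    case 0
    show ?case by (simp add: run_def)
  next
    case (Suc t)
    have p: "(\<pi> ^^ t) permutes {..<n}"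
      using perm by (rule permutes_funpow)
    let ?C = "run n A Z C t"
    \<comment> \<open>After \<open>t\<close> rounds, robot \<open>i\<close> stands where robot
      \<open>(\<pi> ^^ t) i\<close> started, and the occupied points are unchanged. Since snapshots
      carry no identities, it sees the initial snapshot of that robot, though still in its own frame
      \<open>Z i\<close>.\<close>
    have "image_mset (\<lambda>j. Z i (?C j - ?C i)) (mset_set {..<n})
        = image_mset (\<lambda>j. Z i (C ((\<pi> ^^ t) j) - C ((\<pi> ^^ t) i))) (mset_set {..<n})"
      using Suc by (intro image_mset_cong) auto
    also have "\<dots> = image_mset (\<lambda>j. Z i (C j - C ((\<pi> ^^ t) i))) (image_mset (\<pi> ^^ t) (mset_set {..<n}))"
      by (simp add: image_mset.compositionality comp_def)
    also have "image_mset (\<pi> ^^ t) (mset_set {..<n}) = mset_set {..<n}"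
      using permutes_inj_on[OF p] permutes_image[OF p] by (simp add: image_mset_mset_set)
    finally have "snapshot n (Z i) ?C (?C i) = snapshot n (Z i) C (C ((\<pi> ^^ t) i))"
      by (simp add: snapshot_altdef)
    moreover have "(\<pi> ^^ t) i < n"
      using permutes_in_image[OF p, of i] Suc.prems by auto
    ultimately have "A (snapshot n (Z i) ?C (?C i)) = Z i (C (\<pi> ((\<pi> ^^ t) i)) - C ((\<pi> ^^ t) i))"
      using Z Suc.prems A by simp
    moreover have "inj (Z i)"
      using Z Suc.prems local_frameE[of "Z i"] by (metis bij_is_inj)
    ultimately show ?case
      using Suc by (simp add: run_def fsync_round_def)
  qed
  then have "solves_visit_all_1_step n A C"
    unfolding solves_visit_all_1_step_def using \<pi> by blast
  then show ?thesis
    by (auto simp: visit_all_solvable_1_step_def)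
qed

section \<open>Symmetries of solvable configurations\<close>

lemma symmetryI:
  assumes "inj_on C {..<n}" "g ` points n C = points n C"
    and "orthogonal_transformation f" "\<And>z. g z = a + f z"
  obtains \<sigma> where "\<sigma> \<in> symmetries n C" "\<And>i. i < n \<Longrightarrow> C (\<sigma> i) = g (C i)"
proof -
  obtain \<sigma> where "\<sigma> permutes {..<n}" "\<And>i. i < n \<Longrightarrow> C (\<sigma> i) = g (C i)"
    using permutation_of_image_points[OF assms(1,2)] by blast
  moreover from this have "\<sigma> \<in> symmetries n C"
    using assms(3,4) by (auto simp: symmetries_def)
  ultimately show thesis
    using that by blast
qed

lemma axis_symmetry:
  assumes "inj_on C {..<n}" "symmetry_axis n C L"
  obtains \<sigma> where "\<sigma> \<in> symmetries n C" "\<And>i. i < n \<Longrightarrow> C (\<sigma> i) = reflection_in L (C i)"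
proof -
  have L: "is_line L" "reflection_in L ` points n C = points n C"
    using assms(2) by (simp_all add: symmetry_axis_def)
  obtain a u where u: "norm u = 1" "\<And>z. reflection_in L z = a + u * cnj (z - a)"
    using reflection_inE[OF L(1)] by blast
  then have "reflection_in L z = (a - u * cnj a) + u * cnj z" for z
    by (simp add: algebra_simps)
  then show thesis
    using symmetryI[OF assms(1) L(2) orthogonal_transformation_mult_cnj[OF u(1)]] that by blast
qed

lemma cis_2pi_div_neq_1:
  assumes "0 < j" "j < k"
  shows "cis (2 * pi / real k) ^ j \<noteq> 1"
proof -
  have "inj_on (\<lambda>j. cis (2 * pi * real j / real k)) {..<k}"
    using Complex.bij_betw_roots_unity[of k] assms by (simp add: bij_betw_def)
  then have "cis (2 * pi * real j / real k) \<noteq> cis (2 * pi * real 0 / real k)"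
    using assms by (auto dest!: inj_onD[of _ _ j 0])
  then show ?thesis
    by (simp add: Complex.DeMoivre mult_ac)
qed

lemma commuting_fixed_point:
  assumes "\<pi> \<in> n_cycles n" "\<And>j. j < n \<Longrightarrow> \<pi> (\<sigma> j) = \<sigma> (\<pi> j)"
    and "i < n" "\<sigma> i = i" "j < n"
  shows "\<sigma> j = j"
proof -
  have "cyclic_on \<pi> {..<n}"
    using assms(1) by (simp add: n_cycles_def)
  then show ?thesis
    using cyclic_on_commuting_eqI[of \<pi> "{..<n}" i \<sigma> "\<lambda>x. x" j] assms(2-) by simp
qed

text \<open>The rotation fixes the central robot, so by commutation it fixes every robot. But a
  rotation other than the identity fixes only its centre, and distinct robots cannot all be
  there.\<close>

lemma commuting_imp_not_C_odot:
  assumes inj: "inj_on C {..<n}" and "n \<ge> 2" and \<pi>: "\<pi> \<in> n_cycles n"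
    and comm: "\<And>\<sigma> i. \<sigma> \<in> symmetries n C \<Longrightarrow> i < n \<Longrightarrow> \<pi> (\<sigma> i) = \<sigma> (\<pi> i)"
  shows "C \<notin> C_odot n"
proof
  assume "C \<in> C_odot n"
  then obtain c i and k :: nat where i: "i < n" "C i = c" and "k > 1"
    and mset: "image_mset (rotation_about c (2 * pi / real k)) (points_mset n C) = points_mset n C"
    unfolding C_odot_def by blast
  define \<zeta> where "\<zeta> = cis (2 * pi / real k)"
  have "\<zeta> \<noteq> 1"
    using cis_2pi_div_neq_1[of 1 k] \<open>k > 1\<close> by (simp add: \<zeta>_def)
  have "rotation_about c (2 * pi / real k) ` points n C = points n C"
    using arg_cong[OF mset, of set_mset] by (simp add: points_mset_def points_def)
  moreover have "orthogonal_transformation (\<lambda>z. \<zeta> * z)"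
    by (rule orthogonal_transformation_mult) (simp add: \<zeta>_def)
  moreover have "rotation_about c (2 * pi / real k) z = (c - \<zeta> * c) + \<zeta> * z" for z
    by (simp add: rotation_about_def \<zeta>_def algebra_simps)
  ultimately obtain \<sigma> where \<sigma>: "\<sigma> \<in> symmetries n C"
    "\<And>j. j < n \<Longrightarrow> C (\<sigma> j) = rotation_about c (2 * pi / real k) (C j)"
    using symmetryI[OF inj] by blast
  have less: "\<sigma> j < n" if "j < n" for j
    using permutes_in_image[OF symmetries_permutes[OF \<sigma>(1)], of j] that by auto
  have "C (\<sigma> i) = C i"
    using \<sigma>(2) i by (simp add: rotation_about_def)
  then have "\<sigma> i = i"
    using inj less i by (auto simp: inj_on_def)
  then have fixed: "\<sigma> j = j" if "j < n" for j
    using commuting_fixed_point[OF \<pi>, of \<sigma> i j] comm[OF \<sigma>(1)] i(1) \<open>\<sigma> i = i\<close> that by blast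
  have "C j = c" if "j < n" for j
  proof -
    have "(\<zeta> - 1) * (C j - c) = 0"
      using \<sigma>(2)[OF that] fixed[OF that] by (simp add: rotation_about_def \<zeta>_def algebra_simps)
    then show ?thesis
      using \<open>\<zeta> \<noteq> 1\<close> by simp
  qed
  from this[of 0] this[of 1] have "C 0 = C 1"
    using \<open>n \<ge> 2\<close> by simp
  then show False
    using inj_onD[OF inj, of 0 1] \<open>n \<ge> 2\<close> by auto
qed

text \<open>A robot on the axis is fixed by the reflection, hence all robots are fixed and lie on
  the axis, which \<open>symmetry_axis\<close> rules out.\<close>

lemma commuting_imp_axis_disjoint:
  assumes inj: "inj_on C {..<n}" and \<pi>: "\<pi> \<in> n_cycles n"
    and comm: "\<And>\<sigma> i. \<sigma> \<in> symmetries n C \<Longrightarrow> i < n \<Longrightarrow> \<pi> (\<sigma> i) = \<sigma> (\<pi> i)"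
    and L: "symmetry_axis n C L"
  shows "L \<inter> points n C = {}"
proof (rule ccontr)
  assume "L \<inter> points n C \<noteq> {}"
  then obtain i where i: "i < n" "C i \<in> L"
    by (auto simp: points_def)
  have line: "is_line L"
    using L by (simp add: symmetry_axis_def)
  obtain \<sigma> where \<sigma>: "\<sigma> \<in> symmetries n C" "\<And>j. j < n \<Longrightarrow> C (\<sigma> j) = reflection_in L (C j)"
    using axis_symmetry[OF inj L] by blast
  have "C (\<sigma> i) = C i"
    using \<sigma>(2) i reflection_in_fixed_iff[OF line] by simp
  then have "\<sigma> i = i"
    using inj i permutes_in_image[OF symmetries_permutes[OF \<sigma>(1)], of i] by (auto simp: inj_on_def)
  then have "\<sigma> j = j" if "j < n" for j
    using commuting_fixed_point[OF \<pi>, of \<sigma> i j] comm[OF \<sigma>(1)] i(1) \<open>\<sigma> i = i\<close> that by blast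
  then have "reflection_in L (C j) = C j" if "j < n" for j
    using \<sigma>(2)[OF that] that by simp
  then have "points n C \<subseteq> L"
    by (auto simp: points_def simp flip: reflection_in_fixed_iff[OF line])
  then show False
    using L by (simp add: symmetry_axis_def)
qed

text \<open>A cyclic group contains at most one involution.\<close>

lemma commuting_imp_axis_unique:
  assumes inj: "inj_on C {..<n}" and "n > 0" and \<pi>: "\<pi> \<in> n_cycles n"
    and comm: "\<And>\<sigma> i. \<sigma> \<in> symmetries n C \<Longrightarrow> i < n \<Longrightarrow> \<pi> (\<sigma> i) = \<sigma> (\<pi> i)"
    and L: "symmetry_axis n C L" and L': "symmetry_axis n C L'"
  shows "L = L'"
proof -
  \<comment> \<open>The number \<open>funpow_dist1 \<pi> 0 0\<close> is the length of the cycle and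
    does not mention \<open>M\<close>, so all axes send robot 0 to the same place.\<close>
  have *: "\<exists>a. 2 * a = funpow_dist1 \<pi> 0 0 \<and> reflection_in M (C 0) = C ((\<pi> ^^ a) 0)"
    and moved: "C 0 \<notin> M" if M: "symmetry_axis n C M" for M
  proof -
    have line: "is_line M"
      using M by (simp add: symmetry_axis_def)
    show "C 0 \<notin> M"
      using commuting_imp_axis_disjoint[OF inj \<pi> comm M] \<open>n > 0\<close> by (auto simp: points_def)
    obtain \<sigma> where \<sigma>: "\<sigma> \<in> symmetries n C" "\<And>j. j < n \<Longrightarrow> C (\<sigma> j) = reflection_in M (C j)"
      using axis_symmetry[OF inj M] by blast
    have less: "\<sigma> j < n" if "j < n" for j
      using permutes_in_image[OF symmetries_permutes[OF \<sigma>(1)], of j] that by auto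
    have "C (\<sigma> (\<sigma> 0)) = C 0"
      using \<sigma>(2) less \<open>n > 0\<close> reflection_in_involution[OF line] by simp
    then have "\<sigma> (\<sigma> 0) = 0"
      using inj less \<open>n > 0\<close> by (auto simp: inj_on_def)
    moreover have "\<sigma> 0 \<noteq> 0"
      using \<sigma>(2) \<open>n > 0\<close> \<open>C 0 \<notin> M\<close> reflection_in_fixed_iff[OF line] by metis
    moreover have "cyclic_on \<pi> {..<n}"
      using \<pi> by (simp add: n_cycles_def)
    ultimately obtain a where "2 * a = funpow_dist1 \<pi> 0 0" "\<sigma> 0 = (\<pi> ^^ a) 0"
      using cyclic_on_commuting_involution[of \<pi> "{..<n}" 0 \<sigma>] less comm[OF \<sigma>(1)] \<open>n > 0\<close> by auto
    then show "\<exists>a. 2 * a = funpow_dist1 \<pi> 0 0 \<and> reflection_in M (C 0) = C ((\<pi> ^^ a) 0)"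
      using \<sigma>(2)[OF \<open>n > 0\<close>] by auto
  qed
  obtain a b where "2 * a = funpow_dist1 \<pi> 0 0" "reflection_in L (C 0) = C ((\<pi> ^^ a) 0)"
    "2 * b = funpow_dist1 \<pi> 0 0" "reflection_in L' (C 0) = C ((\<pi> ^^ b) 0)"
    using *[OF L] *[OF L'] by blast
  then have "reflection_in L (C 0) = reflection_in L' (C 0)"
    by (metis mult_left_cancel zero_neq_numeral)
  then show ?thesis
    using reflection_in_eqI moved[OF L] L L' by (simp add: symmetry_axis_def)
qed

section \<open>Symmetry groups acting freely\<close>

text \<open>A centre shared by all symmetries: an affine map that permutes the points preserves
  their mean. Relative to it every symmetry is linear, so symmetries compose by multiplying their
  factors.\<close>

definition centroid :: "nat \<Rightarrow> config \<Rightarrow> complex" where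
  "centroid n C = (1 / real n) *\<^sub>R (\<Sum>i<n. C i)"

lemma symmetry_fixes_centroid:
  assumes "\<sigma> permutes {..<n}" "linear f" "\<And>i. i < n \<Longrightarrow> C (\<sigma> i) = a + f (C i)" "i < n"
  shows "C (\<sigma> i) = centroid n C + f (C i - centroid n C)"
proof -
  have "n > 0"
    using assms(4) by simp
  have "(\<Sum>i<n. C i) = (\<Sum>i<n. C (\<sigma> i))"
    using sum.permute[OF assms(1), of C] by (simp add: comp_def)
  also have "\<dots> = real n *\<^sub>R a + f (\<Sum>i<n. C i)"
    using assms(3) by (simp add: sum.distrib linear_sum[OF assms(2)] scaleR_conv_of_real)
  finally have "centroid n C = (1 / real n) *\<^sub>R (real n *\<^sub>R a + f (\<Sum>i<n. C i))"
    by (simp add: centroid_def)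
  also have "\<dots> = a + f (centroid n C)"
    using \<open>n > 0\<close> by (simp add: centroid_def scaleR_add_right linear_scale[OF assms(2)])
  finally have "a = centroid n C - f (centroid n C)"
    by (metis add_diff_cancel_right')
  then show ?thesis
    using assms(3)[OF assms(4)] by (simp add: linear_diff[OF assms(2)])
qed

lemma symmetries_cases:
  assumes "\<sigma> \<in> symmetries n C"
  obtains (rotation) u where "norm u = 1"
      "\<And>i. i < n \<Longrightarrow> C (\<sigma> i) = centroid n C + u * (C i - centroid n C)"
    | (reflection) u where "norm u = 1"
      "\<And>i. i < n \<Longrightarrow> C (\<sigma> i) = centroid n C + u * cnj (C i - centroid n C)"
proof -
  obtain a f where f: "orthogonal_transformation f" "\<And>i. i < n \<Longrightarrow> C (\<sigma> i) = a + f (C i)"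
    using assms by (auto simp: symmetries_def)
  have C\<sigma>: "C (\<sigma> i) = centroid n C + f (C i - centroid n C)" if "i < n" for i
    using symmetries_permutes[OF assms] orthogonal_transformation_linear[OF f(1)] f(2) that
    by (rule symmetry_fixes_centroid)
  obtain u where u: "norm u = 1" and "f = (\<lambda>z. u * z) \<or> f = (\<lambda>z. u * cnj z)"
    using orthogonal_transformation_complex[OF f(1)] .
  from this(2) show thesis
  proof
    assume "f = (\<lambda>z. u * z)"
    with C\<sigma> show thesis
      by (intro rotation[OF u]) simp
  next
    assume "f = (\<lambda>z. u * cnj z)"
    with C\<sigma> show thesis
      by (intro reflection[OF u]) simp
  qed
qed

text \<open>The first alternative is the collinear case: if the mirror line contains all robots, it
  is not a \<open>symmetry_axis\<close>, but then the reflection moves no robot.\<close>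

lemma reflection_symmetry_cases:
  assumes inj: "inj_on C {..<n}" and \<sigma>: "\<sigma> permutes {..<n}" and "norm u = 1"
    and C\<sigma>: "\<And>i. i < n \<Longrightarrow> C (\<sigma> i) = a + u * cnj (C i - a)"
  shows "(\<forall>i<n. \<sigma> i = i) \<or>
    (\<exists>L. symmetry_axis n C L \<and> (\<forall>i<n. C (\<sigma> i) = reflection_in L (C i)))"
proof -
  obtain L where L: "is_line L" "\<And>z. reflection_in L z = a + u * cnj (z - a)"
    using ex_line_reflection[OF \<open>norm u = 1\<close>] by blast
  have eq: "C (\<sigma> i) = reflection_in L (C i)" if "i < n" for i
    using that by (simp add: C\<sigma> L(2))
  have "reflection_in L ` points n C = (\<lambda>i. C (\<sigma> i)) ` {..<n}"
    using eq by (simp add: points_def image_image)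
  also have "\<dots> = points n C"
    using permutes_image[OF \<sigma>] by (simp add: points_def flip: image_image)
  finally have image: "reflection_in L ` points n C = points n C" .
  show ?thesis
  proof (cases "points n C \<subseteq> L")
    case True
    have "\<sigma> i = i" if "i < n" for i
    proof -
      have "C i \<in> L"
        using True that by (auto simp: points_def)
      then have "C (\<sigma> i) = C i"
        using eq[OF that] reflection_in_fixed_iff[OF L(1)] by simp
      then show ?thesis
        using inj that permutes_in_image[OF \<sigma>, of i] by (auto simp: inj_on_def)
    qed
    then show ?thesis by blast
  next
    case False
    then show ?thesis
      using L(1) image eq by (auto simp: symmetry_axis_def)
  qed
qed

text \<open>A group of \<open>k\<close> rotations consists of \<open>k\<close>-th roots of unity, hence of all of them.\<close>

lemma rotation_group_eq_roots_unity:
  fixes P :: "complex set"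
  assumes "finite P" "p \<in> P" "p \<noteq> 0"
  defines "R \<equiv> {u. norm u = 1 \<and> (\<lambda>z. u * z) ` P = P}"
  shows "card R > 0" "R = {u. u ^ card R = 1}"
proof -
  \<comment> \<open>A rotation about 0 is determined by the image of the nonzero point
    \<open>p\<close>, so there are at most as many rotations as points.\<close>
  have "u \<in> (\<lambda>q. q / p) ` P" if "u \<in> R" for u
  proof -
    have "u * p \<in> P"
      using that \<open>p \<in> P\<close> by (auto simp: R_def)
    then show ?thesis
      using \<open>p \<noteq> 0\<close> by (auto intro!: image_eqI[of _ _ "u * p"])
  qed
  then have "finite R"
    using \<open>finite P\<close> by (meson finite_imageI finite_subset subsetI)
  have "1 \<in> R"
    by (simp add: R_def)
  show "card R > 0"
    using \<open>finite R\<close> \<open>1 \<in> R\<close> by (auto simp: card_gt_0_iff)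
  have nonzero: "u \<noteq> 0" if "u \<in> R" for u
    using that by (auto simp: R_def)
  have mult: "u * v \<in> R" if "u \<in> R" "v \<in> R" for u v
  proof -
    have "(\<lambda>z. u * v * z) ` P = (\<lambda>z. u * z) ` (\<lambda>z. v * z) ` P"
      by (simp add: image_image mult.assoc)
    then show ?thesis
      using that by (simp add: R_def norm_mult)
  qed
  have power: "u ^ card R = 1" if "u \<in> R" for u
  proof -
    have "inj_on (\<lambda>v. u * v) R"
      using nonzero[OF that] by (simp add: inj_on_def)
    moreover have "(\<lambda>v. u * v) ` R \<subseteq> R"
      using mult[OF that] by auto
    ultimately have bij: "bij_betw (\<lambda>v. u * v) R R"
      using \<open>finite R\<close> by (simp add: bij_betw_def endo_inj_surj)
    \<comment> \<open>Multiplication by \<open>u\<close> permutes \<open>R\<close>; cancelling the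
      product of all elements leaves \<open>u ^ card R = 1\<close>.\<close>
    have "(\<Prod>v\<in>R. v) = (\<Prod>v\<in>R. u * v)"
      using prod.reindex_bij_betw[OF bij, of "\<lambda>v. v"] by simp
    also have "\<dots> = u ^ card R * (\<Prod>v\<in>R. v)"
      by (simp add: prod.distrib)
    finally show ?thesis
      using nonzero \<open>finite R\<close> by simp
  qed
  show "R = {u. u ^ card R = 1}"
  proof (rule card_subset_eq)
    show "finite {u::complex. u ^ card R = 1}"
      using \<open>card R > 0\<close> by (intro finite_roots_unity) simp
    show "R \<subseteq> {u. u ^ card R = 1}"
      using power by blast
    show "card R = card {u::complex. u ^ card R = 1}"
      using card_roots_unity_eq[OF \<open>card R > 0\<close>] by simp
  qed
qed

text \<open>A disc that contains a rotationally symmetric set contains it in all rotated positions too;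
  the average of the rotated centres is the centre of the rotation.\<close>

lemma rotation_centre_imp_C_odot:
  assumes inj: "inj_on C {..<n}" and "k > 1" and i: "i < n" "C i = c"
    and image: "rotation_about c (2 * pi / real k) ` points n C = points n C"
  shows "C \<in> C_odot n"
proof -
  define \<zeta> where "\<zeta> = cis (2 * pi / real k)"
  define r where "r = Max (dist c ` points n C)"
  have fin: "finite (points n C)" and "points n C \<noteq> {}"
    using i by (auto simp: points_def)
  have rot: "c + \<zeta> * (z - c) \<in> points n C" if "z \<in> points n C" for z
    using image that by (force simp: rotation_about_def \<zeta>_def)
  have rots: "c + \<zeta> ^ j * (z - c) \<in> points n C" if "z \<in> points n C" for z j
  proof (induction j)
    case (Suc j)
    then show ?case
      using rot[OF Suc] by (simp add: mult.assoc)
  qed (use that in simp)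
  have "smallest_enclosing_circle (points n C) c r"
    unfolding smallest_enclosing_circle_def
  proof (intro conjI allI impI)
    show "points n C \<subseteq> cball c r"
      using fin by (auto simp: r_def)
    fix c' r' assume sub: "points n C \<subseteq> cball c' r'"
    have "dist c z \<le> r'" if z: "z \<in> points n C" for z
    proof -
      have "cnj \<zeta> \<noteq> 1"
        using cis_2pi_div_neq_1[of 1 k] \<open>k > 1\<close> by (simp add: \<zeta>_def)
      moreover have "\<zeta> ^ k = 1"
        using \<open>k > 1\<close> by (simp add: \<zeta>_def Complex.DeMoivre)
      then have "cnj \<zeta> ^ k = 1"
        by (simp flip: complex_cnj_power)
      ultimately have zero: "(\<Sum>j<k. cnj \<zeta> ^ j) = 0"
        by (simp add: geometric_sum)
      \<comment> \<open>Comparing the rotated point with \<open>c'\<close> amounts to comparing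
        \<open>z\<close> with \<open>c'\<close> rotated backwards. In the sum over \<open>j\<close>
        the terms in \<open>c'\<close> then cancel by \<open>zero\<close>.\<close>
      have "norm ((z - c) - cnj \<zeta> ^ j * (c' - c)) \<le> r'" for j
      proof -
        have "cnj \<zeta> ^ j * \<zeta> ^ j = 1"
          using norm_one_mult_cnj[of \<zeta>] by (simp add: \<zeta>_def flip: power_mult_distrib)
        then have "(z - c) - cnj \<zeta> ^ j * (c' - c) = cnj \<zeta> ^ j * (c + \<zeta> ^ j * (z - c) - c')"
          by (simp add: algebra_simps)
        then have "norm ((z - c) - cnj \<zeta> ^ j * (c' - c)) = dist c' (c + \<zeta> ^ j * (z - c))"
          by (simp add: \<zeta>_def norm_mult norm_power dist_norm norm_minus_commute)
        then show ?thesis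
          using subsetD[OF sub rots[OF z, of j]] by simp
      qed
      then have "norm (\<Sum>j<k. (z - c) - cnj \<zeta> ^ j * (c' - c)) \<le> real k * r'"
        using sum_norm_bound[of "{..<k}" "\<lambda>j. (z - c) - cnj \<zeta> ^ j * (c' - c)" r'] by simp
      also have "(\<Sum>j<k. (z - c) - cnj \<zeta> ^ j * (c' - c)) = of_nat k * (z - c)"
        by (simp add: sum_subtractf zero flip: sum_distrib_right)
      finally show ?thesis
        using \<open>k > 1\<close> by (simp add: norm_mult dist_norm norm_minus_commute)
    qed
    then show "r \<le> r'"
      using fin \<open>points n C \<noteq> {}\<close> by (simp add: r_def)
  qed
  moreover have "\<exists>!i. i < n \<and> C i = c"
    using inj i by (auto simp: inj_on_def)
  moreover have "image_mset (rotation_about c (2 * pi / real k)) (points_mset n C) = points_mset n C"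
  proof -
    have "points_mset n C = mset_set (points n C)"
      using inj by (simp add: points_mset_def points_def image_mset_mset_set)
    moreover have "inj_on (rotation_about c (2 * pi / real k)) (points n C)"
      by (simp add: inj_on_def rotation_about_def)
    ultimately show ?thesis
      by (simp add: image_mset_mset_set image)
  qed
  ultimately show ?thesis
    unfolding C_odot_def using \<open>k > 1\<close> by blast
qed

text \<open>A cycle that commutes with a generator commutes with all its powers. Both solvable cases
  thus reduce to finding a generator whose cycles on the robots all have the same length
  \<open>k\<close>.\<close>

lemma symmetries_powers_imp_solvable:
  assumes inj: "inj_on C {..<n}" and "n \<ge> 2" and \<sigma>: "\<sigma> permutes {..<n}" and "k > 0"
    and "\<And>i. i < n \<Longrightarrow> (\<sigma> ^^ k) i = i"
    and "\<And>i j. i < n \<Longrightarrow> 0 < j \<Longrightarrow> j < k \<Longrightarrow> (\<sigma> ^^ j) i \<noteq> i"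
    and powers: "\<And>\<tau>. \<tau> \<in> symmetries n C \<Longrightarrow> \<exists>j. \<forall>i<n. \<tau> i = (\<sigma> ^^ j) i"
  shows "visit_all_solvable_1_step n C"
proof -
  obtain \<pi> where \<pi>: "\<pi> permutes {..<n}" "cyclic_on \<pi> {..<n}" "\<And>i. i < n \<Longrightarrow> \<pi> (\<sigma> i) = \<sigma> (\<pi> i)"
    using ex_cyclic_commuting[of "{..<n}" \<sigma> k] assms by (auto simp: lessThan_empty_iff)
  have less: "\<sigma> i < n" "\<pi> i < n" if "i < n" for i
    using permutes_in_image[OF \<sigma>, of i] permutes_in_image[OF \<pi>(1), of i] that by auto
  have "\<pi> (\<tau> i) = \<tau> (\<pi> i)" if "\<tau> \<in> symmetries n C" "i < n" for \<tau> i
  proof -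
    obtain j where "\<And>i. i < n \<Longrightarrow> \<tau> i = (\<sigma> ^^ j) i"
      using powers \<open>\<tau> \<in> symmetries n C\<close> by blast
    then show ?thesis
      using funpow_commute_on[of "{..<n}" \<pi> \<sigma> i j] \<pi>(3) less \<open>i < n\<close> by simp
  qed
  then show ?thesis
    using commuting_imp_solvable[OF inj \<open>n \<ge> 2\<close>] \<pi> by (simp add: n_cycles_def)
qed

text \<open>Without an axis only rotations about the centroid can move robots. Their factors are all
  the \<open>k\<close>-th roots of unity, generated by \<zeta>. If \<open>k > 1\<close>, then
  \<open>C \<notin> C_odot n\<close> keeps robots away from the centroid, so all orbits have length
  \<open>k\<close>; if \<open>k = 1\<close>, the generator is the identity.\<close>

lemma no_axis_imp_solvable:
  assumes inj: "inj_on C {..<n}" and "n \<ge> 2" and "C \<notin> C_odot n"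
    and no_axis: "\<nexists>L. symmetry_axis n C L"
  shows "visit_all_solvable_1_step n C"
proof -
  define m where "m = centroid n C"
  define P where "P = (\<lambda>z. z - m) ` points n C"
  define R where "R = {u. norm u = 1 \<and> (\<lambda>z. u * z) ` P = P}"
  define k where "k = card R"
  define \<zeta> where "\<zeta> = cis (2 * pi / real k)"
  have "finite P"
    by (simp add: P_def points_def)
  obtain p where p: "p \<in> P" "p \<noteq> 0"
  proof -
    have "C 0 \<noteq> C 1"
      using inj_onD[OF inj, of 0 1] \<open>n \<ge> 2\<close> by auto
    then have "C 0 - m \<noteq> 0 \<or> C 1 - m \<noteq> 0"
      by auto
    moreover have "C 0 - m \<in> P" "C 1 - m \<in> P"
      using \<open>n \<ge> 2\<close> by (auto simp: P_def points_def)
    ultimately show thesis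
      using that by blast
  qed
  have "k > 0" and R: "R = {u. u ^ k = 1}"
    using rotation_group_eq_roots_unity[OF \<open>finite P\<close> p] unfolding k_def R_def by blast+
  have \<zeta>_pow: "\<zeta> ^ j = cis (2 * pi * real j / real k)" for j
    by (simp add: \<zeta>_def Complex.DeMoivre mult_ac)
  have "\<zeta> ^ k = 1"
    using \<open>k > 0\<close> by (simp add: \<zeta>_pow)
  then have "\<zeta> \<in> R"
    by (simp add: R)
  have image: "(\<lambda>z. m + \<zeta> * (z - m)) ` points n C = points n C"
  proof -
    have "(\<lambda>z. m + \<zeta> * (z - m)) ` points n C = (\<lambda>z. m + z) ` (\<lambda>z. \<zeta> * z) ` P"
      by (simp add: P_def image_image)
    also have "(\<lambda>z. \<zeta> * z) ` P = P"
      using \<open>\<zeta> \<in> R\<close> by (simp add: R_def)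
    finally show ?thesis
      by (simp add: P_def image_image)
  qed
  then obtain \<sigma> where \<sigma>: "\<sigma> permutes {..<n}" "\<And>i. i < n \<Longrightarrow> C (\<sigma> i) = m + \<zeta> * (C i - m)"
    using permutation_of_image_points[OF inj] by blast
  have less: "(\<sigma> ^^ j) i < n" if "i < n" for i j
    using permutes_in_image[OF permutes_funpow[OF \<sigma>(1)], of j i] that by auto
  have C_pow: "C ((\<sigma> ^^ j) i) = m + \<zeta> ^ j * (C i - m)" if "i < n" for i j
    by (induction j) (simp_all add: \<sigma>(2) less[OF that] mult.assoc)
  have index_eq: "i = j" if "C i = C j" "i < n" "j < n" for i j
    using inj that by (auto simp: inj_on_def)
  show ?thesis
  proof (rule symmetries_powers_imp_solvable[OF inj \<open>n \<ge> 2\<close> \<sigma>(1) \<open>k > 0\<close>])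
    show "(\<sigma> ^^ k) i = i" if "i < n" for i
      using C_pow[OF that, of k] \<open>\<zeta> ^ k = 1\<close> less[OF that] that by (intro index_eq) auto
    show "(\<sigma> ^^ j) i \<noteq> i" if "i < n" "0 < j" "j < k" for i j
    proof
      assume "(\<sigma> ^^ j) i = i"
      then have "(\<zeta> ^ j - 1) * (C i - m) = 0"
        using C_pow[OF \<open>i < n\<close>, of j] by (simp add: algebra_simps)
      moreover have "\<zeta> ^ j \<noteq> 1"
        using cis_2pi_div_neq_1 that by (simp add: \<zeta>_def)
      ultimately have "C i = m"
        by simp
      moreover have "rotation_about m (2 * pi / real k) ` points n C = points n C"
        using image by (simp add: rotation_about_def \<zeta>_def)
      ultimately show False
        using rotation_centre_imp_C_odot[OF inj, of k i m] that \<open>C \<notin> C_odot n\<close> by simp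
    qed
    show "\<exists>j. \<forall>i<n. \<tau> i = (\<sigma> ^^ j) i" if \<tau>: "\<tau> \<in> symmetries n C" for \<tau>
      using \<tau>
    proof (cases rule: symmetries_cases)
      case (rotation u)
      have perm: "\<tau> permutes {..<n}"
        using \<tau> by (rule symmetries_permutes)
      have "(\<lambda>z. u * z) ` P = (\<lambda>i. C (\<tau> i) - m) ` {..<n}"
        using rotation(2) by (simp add: P_def points_def image_image m_def)
      also have "\<dots> = (\<lambda>z. z - m) ` C ` \<tau> ` {..<n}"
        by (simp add: image_image)
      also have "\<dots> = P"
        by (simp add: P_def points_def permutes_image[OF perm])
      finally have "u \<in> {u. u ^ k = 1}"
        unfolding R[symmetric] using rotation(1) by (simp add: R_def)
      also have "\<dots> = (\<lambda>j. \<zeta> ^ j) ` {..<k}"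
        using Complex.bij_betw_roots_unity[OF \<open>k > 0\<close>] by (simp add: bij_betw_def \<zeta>_pow)
      finally obtain j where "u = \<zeta> ^ j"
        by blast
      then have "C (\<tau> i) = C ((\<sigma> ^^ j) i)" if "i < n" for i
        using that by (simp add: rotation(2) C_pow m_def)
      then have "\<forall>i<n. \<tau> i = (\<sigma> ^^ j) i"
        using less permutes_in_image[OF perm] by (auto intro!: index_eq)
      then show ?thesis ..
    next
      case (reflection u)
      \<comment> \<open>With no axis available, the mirror line must contain all robots, so \<tau>
        acts as the identity.\<close>
      then have "\<forall>i<n. \<tau> i = (\<sigma> ^^ 0) i"
        using reflection_symmetry_cases[OF inj symmetries_permutes[OF \<tau>]] no_axis by fastforce
      then show ?thesis ..
    qed
  qed
qed

text \<open>A rotation followed or preceded by the reflection \<sigma> would give another axis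
  unless it moves no robot or equals \<sigma>. So the symmetries are just the identity and \<sigma>,
  and \<sigma> moves every robot because none lies on the axis.\<close>

lemma unique_axis_imp_solvable:
  assumes inj: "inj_on C {..<n}" and "n \<ge> 2" and L: "symmetry_axis n C L"
    and unique: "\<And>L'. symmetry_axis n C L' \<Longrightarrow> L' = L" and disjoint: "L \<inter> points n C = {}"
  shows "visit_all_solvable_1_step n C"
proof -
  have line: "is_line L"
    using L by (simp add: symmetry_axis_def)
  obtain \<sigma> where \<sigma>: "\<sigma> \<in> symmetries n C" "\<And>i. i < n \<Longrightarrow> C (\<sigma> i) = reflection_in L (C i)"
    using axis_symmetry[OF inj L] by blast
  have perm: "\<sigma> permutes {..<n}"
    using \<sigma>(1) by (rule symmetries_permutes)
  have less: "\<sigma> i < n" if "i < n" for i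
    using permutes_in_image[OF perm, of i] that by auto
  have index_eq: "i = j" if "C i = C j" "i < n" "j < n" for i j
    using inj that by (auto simp: inj_on_def)
  have involution: "\<sigma> (\<sigma> i) = i" if "i < n" for i
    using that less reflection_in_involution[OF line] by (intro index_eq) (auto simp: \<sigma>(2))
  have moved: "\<sigma> i \<noteq> i" if "i < n" for i
  proof
    assume "\<sigma> i = i"
    then have "C i \<in> L"
      using \<sigma>(2)[OF that] reflection_in_fixed_iff[OF line] by metis
    then show False
      using disjoint that by (auto simp: points_def)
  qed
  have reflected: "(\<forall>i<n. \<tau> i = i) \<or> (\<forall>i<n. \<tau> i = \<sigma> i)"
    if "\<tau> permutes {..<n}" "norm u = 1" "\<And>i. i < n \<Longrightarrow> C (\<tau> i) = a + u * cnj (C i - a)" for \<tau> u a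
  proof -
    have "\<tau> i = \<sigma> i" if "C (\<tau> i) = reflection_in L (C i)" "i < n" for i
      using that \<sigma>(2) less permutes_in_image[OF \<open>\<tau> permutes {..<n}\<close>, of i] by (intro index_eq) auto
    then show ?thesis
      using reflection_symmetry_cases[OF inj that] unique by blast
  qed
  show ?thesis
  proof (rule symmetries_powers_imp_solvable[OF inj \<open>n \<ge> 2\<close> perm])
    show "(\<sigma> ^^ 2) i = i" if "i < n" for i
      using involution[OF that] by (simp add: numeral_2_eq_2)
    show "(\<sigma> ^^ j) i \<noteq> i" if "i < n" "0 < j" "j < 2" for i j
    proof -
      have "j = 1"
        using that by simp
      then show ?thesis
        using moved \<open>i < n\<close> by simp
    qed
    show "\<exists>j. \<forall>i<n. \<tau> i = (\<sigma> ^^ j) i" if \<tau>: "\<tau> \<in> symmetries n C" for \<tau>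
    proof -
      have perm': "\<tau> permutes {..<n}"
        using \<tau> by (rule symmetries_permutes)
      have "(\<forall>i<n. \<tau> i = i) \<or> (\<forall>i<n. \<tau> i = \<sigma> i)"
        using \<tau>
      proof (cases rule: symmetries_cases)
        case (rotation u)
        obtain a v where v: "norm v = 1" "\<And>z. reflection_in L z = a + v * cnj (z - a)"
          using reflection_inE[OF line] by blast
        \<comment> \<open>The reflection is rebased from a point \<open>a\<close> of its formula to
          the centroid, so that its factor multiplies with that of the rotation.\<close>
        have "C (\<sigma> i) = centroid n C + v * cnj (C i - centroid n C)" if "i < n" for i
        proof (rule symmetry_fixes_centroid[OF perm _ _ that])
          show "linear (\<lambda>z. v * cnj z)"
            using orthogonal_transformation_mult_cnj[OF v(1)] by (rule orthogonal_transformation_linear)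
          show "C (\<sigma> i) = (a - v * cnj a) + v * cnj (C i)" if "i < n" for i
            using that by (simp add: \<sigma>(2) v(2) algebra_simps)
        qed
        then have "C ((\<tau> \<circ> \<sigma>) i) = centroid n C + (u * v) * cnj (C i - centroid n C)" if "i < n" for i
          using that less rotation(2) by (simp add: mult.assoc)
        then have *: "(\<forall>i<n. (\<tau> \<circ> \<sigma>) i = i) \<or> (\<forall>i<n. (\<tau> \<circ> \<sigma>) i = \<sigma> i)"
          using rotation(1) v(1) by (intro reflected[OF permutes_compose[OF perm perm']]) (auto simp: norm_mult)
        \<comment> \<open>Since \<sigma> is an involution, the rotation is recovered from the
          composite, which is already known to be the identity or \<sigma>.\<close>
        have \<tau>: "\<tau> i = (\<tau> \<circ> \<sigma>) (\<sigma> i)" if "i < n" for i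
          using involution[OF that] by simp
        from * show ?thesis
        proof
          assume id: "\<forall>i<n. (\<tau> \<circ> \<sigma>) i = i"
          have "\<tau> i = \<sigma> i" if "i < n" for i
            unfolding \<tau>[OF that] using id less[OF that] by blast
          then show ?thesis by blast
        next
          assume id: "\<forall>i<n. (\<tau> \<circ> \<sigma>) i = \<sigma> i"
          have "\<tau> i = i" if "i < n" for i
          proof -
            have "\<tau> i = \<sigma> (\<sigma> i)"
              unfolding \<tau>[OF that] using id less[OF that] by blast
            then show ?thesis
              using involution[OF that] by simp
          qed
          then show ?thesis by blast
        qed
      next
        case (reflection u)
        then show ?thesis
          using perm' by (intro reflected)
      qed
      then have "(\<forall>i<n. \<tau> i = (\<sigma> ^^ 0) i) \<or> (\<forall>i<n. \<tau> i = (\<sigma> ^^ 1) i)"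
        by simp
      then show ?thesis by blast
    qed
  qed simp
qed

theorem theorem11:
  fixes n :: nat and C\<^sub>0 :: config
  assumes "n \<ge> 3" and "initial_config n C\<^sub>0"
  shows "visit_all_solvable_1_step n C\<^sub>0 \<longleftrightarrow>
    C\<^sub>0 \<notin> C_odot n \<and>
    ((\<nexists>L. symmetry_axis n C\<^sub>0 L) \<or>
     ((\<exists>!L. symmetry_axis n C\<^sub>0 L) \<and>
      (\<forall>L. symmetry_axis n C\<^sub>0 L \<longrightarrow> L \<inter> points n C\<^sub>0 = {})))"
proof
  have inj: "inj_on C\<^sub>0 {..<n}" and "n \<ge> 2" "n > 0"
    using assms by (simp_all add: initial_config_def)
  {
    assume "visit_all_solvable_1_step n C\<^sub>0"
    then obtain A where "solves_visit_all_1_step n A C\<^sub>0"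
      by (auto simp: visit_all_solvable_1_step_def)
    then obtain \<pi> where \<pi>: "\<pi> \<in> n_cycles n"
      "\<And>\<sigma> i. \<sigma> \<in> symmetries n C\<^sub>0 \<Longrightarrow> i < n \<Longrightarrow> \<pi> (\<sigma> i) = \<sigma> (\<pi> i)"
      using inj by (rule solves_imp_commuting) blast
    have "C\<^sub>0 \<notin> C_odot n"
      using inj \<open>n \<ge> 2\<close> \<pi> by (rule commuting_imp_not_C_odot)
    moreover have "L \<inter> points n C\<^sub>0 = {}" if "symmetry_axis n C\<^sub>0 L" for L
      using inj \<pi> that by (rule commuting_imp_axis_disjoint)
    moreover have "L = L'" if "symmetry_axis n C\<^sub>0 L" "symmetry_axis n C\<^sub>0 L'" for L L'
      using inj \<open>n > 0\<close> \<pi> that by (rule commuting_imp_axis_unique)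
    ultimately show "C\<^sub>0 \<notin> C_odot n \<and> ((\<nexists>L. symmetry_axis n C\<^sub>0 L) \<or>
        ((\<exists>!L. symmetry_axis n C\<^sub>0 L) \<and>
         (\<forall>L. symmetry_axis n C\<^sub>0 L \<longrightarrow> L \<inter> points n C\<^sub>0 = {})))"
      by metis
  next
    assume condition: "C\<^sub>0 \<notin> C_odot n \<and> ((\<nexists>L. symmetry_axis n C\<^sub>0 L) \<or>
        ((\<exists>!L. symmetry_axis n C\<^sub>0 L) \<and>
         (\<forall>L. symmetry_axis n C\<^sub>0 L \<longrightarrow> L \<inter> points n C\<^sub>0 = {})))"
    show "visit_all_solvable_1_step n C\<^sub>0"
    proof (cases "\<exists>L. symmetry_axis n C\<^sub>0 L")
      case True
      then obtain L where L: "symmetry_axis n C\<^sub>0 L"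
        by blast
      moreover have "L' = L" if "symmetry_axis n C\<^sub>0 L'" for L'
        using condition L that by metis
      moreover have "L \<inter> points n C\<^sub>0 = {}"
        using condition L by metis
      ultimately show ?thesis
        using inj \<open>n \<ge> 2\<close> unique_axis_imp_solvable by metis
    next
      case False
      then show ?thesis
        using inj \<open>n \<ge> 2\<close> condition no_axis_imp_solvable by metis
    qed
  }
qed

end
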